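(* (Realization lemma) Let $\Lambda=kQ/(\rho)$ be a string algebra. If $M$ is a finitely controlled or pointwise artinian $\Lambda$-module and $C$ is an $\mathbb N$-word, then $C^+(M)=\bigcap_{n\ge0}C_{\le n}M$.
   Context: String algebras. Let $k$ be a field, $Q$ a quiver (not necessarily finite), $kQ$ its path algebra; a product $xy$ of arrows is a path when the tail of $x$ equals the head of $y$ (first $y$, then $x$). Let $\rho$ be a set of paths of length $\ge 2$ ("zero relations"). $\Lambda=kQ/(\rho)$ is a string algebra if (a) every vertex of $Q$ is the head of at most two arrows and the tail of at most two arrows, and (b) for any arrow $y$ there is at most one path $xy$ of length 2 with $xy\notin\rho$ and at most one path $yz$ of length 2 with $yz\notin\rho$. $e_v$ is the trivial path at the vertex $v$. A $\Lambda$-module is a left module $M$ with $\Lambda M=M$ (equivalently $M=\bigoplus_v e_vM$). $M$ is finitely controlled if for every vertex $v$ the set $e_vM$ is contained in a finitely generated submodule of $M$; it is pointwise artinian if for any descending chain of submodules $M_1\supseteq M_2\supseteq\dots$ and any vertex $v$ the chain $e_vM_1\supseteq e_vM_2\supseteq\dots$ stabilizes. Words. A letter is an arrow $x$ (direct letter) or its formal inverse $x^{-1}$ (inverse letter); the head of $x^{-1}$ is the tail of $x$ and vice versa; $(x^{-1})^{-1}=x$. An $\mathbb N$-word is an infinite sequence of letters $C=C_1C_2C_3\dots$ such that for consecutive letters the tail of $C_i$ is the head of $C_{i+1}$ and $C_i^{-1}\ne C_{i+1}$, and no zero relation $x_1\dots x_m\in\rho$ nor its inverse $x_m^{-1}\dots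 x_1^{-1}$ occurs as a sequence of consecutive letters. $C_{\le n}=C_1\dots C_n$ (for $n=0$, a trivial word at the head of $C_1$). Relations. A linear relation from $V$ to $W$ is a subspace $C\subseteq V\oplus W$; $Cv=\{w:(v,w)\in C\}$, $CH=\bigcup_{v\in H}Cv$, with the usual composition and inverse. An arrow $x$ with tail $u$ and head $v$ gives (the graph of) a relation from $e_uM$ to $e_vM$; by composing these and their inverses, a finite word $D$ with head $v$ (the head of its first letter) and tail $u$ (the tail of its last letter) gives a linear relation from $e_uM$ to $e_vM$ (trivial words give the identity), and $DM$ denotes $D(e_uM)\subseteq e_vM$. For an $\mathbb N$-word $C$, $C^+(M)$ is the set of $m\in M$ for which there is a sequence $m_n\in M$ ($n\ge0$) with $m_0=m$ and $m_{n-1}\in C_nm_n$ for all $n\ge1$. *)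

theory Defs
  imports
    "HOL-Library.Poly_Mapping"
    "HOL-Algebra.QuotRing"
    "Graph_Theory.Digraph"
begin

section \<open>Path algebras\<close>

text \<open>
  A quiver is a \<^locale>\<open>wf_digraph\<close>; vertex and arrow sets may be infinite.
  The pair \<open>(v, [x\<^sub>1, \<dots>, x\<^sub>n])\<close> stands for the path \<open>x\<^sub>1 \<cdots> x\<^sub>n\<close> with head \<open>v\<close>; it is
  written like a composite of maps, so \<open>x\<^sub>n\<close> comes first and the tail of each arrow is
  the head of the next one in the list.  The trivial path at \<open>v\<close> is \<open>(v, [])\<close>.
\<close>

type_synonym ('v, 'a) qpath = "'v \<times> 'a list"

definition qpaths :: "('v, 'a) pre_digraph \<Rightarrow> ('v, 'a) qpath set" where
  "qpaths Q = {(v, xs). v \<in> verts Q \<and> set xs \<subseteq> arcs Q \<and> (xs \<noteq> [] \<longrightarrow> head Q (hd xs) = v) \<and>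
     successively (\<lambda>x y. tail Q x = head Q y) xs}"

fun qpath_tail :: "('v, 'a) pre_digraph \<Rightarrow> ('v, 'a) qpath \<Rightarrow> 'v" where
  "qpath_tail Q (v, xs) = (if xs = [] then v else tail Q (last xs))"

definition path_mult ::
  "('v, 'a) pre_digraph \<Rightarrow> (('v, 'a) qpath \<Rightarrow>\<^sub>0 'k::field) \<Rightarrow> (('v, 'a) qpath \<Rightarrow>\<^sub>0 'k) \<Rightarrow> (('v, 'a) qpath \<Rightarrow>\<^sub>0 'k)"
where
  "path_mult Q a b = (\<Sum>p\<in>Poly_Mapping.keys a. \<Sum>q\<in>Poly_Mapping.keys b.
     if qpath_tail Q p = fst q
     then Poly_Mapping.single (fst p, snd p @ snd q)
            (Poly_Mapping.lookup a p * Poly_Mapping.lookup b q)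
     else 0)"

text \<open>
  The record component \<open>one\<close> below is a unit only if \<open>Q\<close> has finitely many vertices (otherwise \<open>kQ\<close> has
  no unit, and the sum is 0); nothing in this theory uses it.  For the same reason the
  library's \<^const>\<open>genideal\<close>, which presupposes a unital ring, is not used for \<open>(\<rho>)\<close>.
\<close>

definition path_algebra :: "('v, 'a) pre_digraph \<Rightarrow> (('v, 'a) qpath \<Rightarrow>\<^sub>0 'k::field) ring" where
  "path_algebra Q =
    \<lparr>carrier = {a. Poly_Mapping.keys a \<subseteq> qpaths Q},
     mult = path_mult Q,
     one = (\<Sum>v\<in>verts Q. Poly_Mapping.single (v, []) 1),
     zero = 0,
     add = (+)\<rparr>"

definition two_sided_ideal :: "('r, 'b) ring_scheme \<Rightarrow> 'r set \<Rightarrow> bool" where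
  "two_sided_ideal R I \<longleftrightarrow> additive_subgroup I R \<and>
     (\<forall>a\<in>carrier R. \<forall>i\<in>I. a \<otimes>\<^bsub>R\<^esub> i \<in> I \<and> i \<otimes>\<^bsub>R\<^esub> a \<in> I)"

definition relation_ideal ::
  "('v, 'a) pre_digraph \<Rightarrow> ('v, 'a) qpath set \<Rightarrow> (('v, 'a) qpath \<Rightarrow>\<^sub>0 'k::field) set" where
  "relation_ideal Q \<rho> =
     two_sided_ideal (path_algebra Q) hull ((\<lambda>r. Poly_Mapping.single r 1) ` \<rho>)"

definition quiver_algebra ::
  "('v, 'a) pre_digraph \<Rightarrow> ('v, 'a) qpath set \<Rightarrow> (('v, 'a) qpath \<Rightarrow>\<^sub>0 'k::field) set ring" where
  "quiver_algebra Q \<rho> = path_algebra Q Quot relation_ideal Q \<rho>"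

definition path_class ::
  "('v, 'a) pre_digraph \<Rightarrow> ('v, 'a) qpath set \<Rightarrow> ('v, 'a) qpath \<Rightarrow> (('v, 'a) qpath \<Rightarrow>\<^sub>0 'k::field) set" where
  "path_class Q \<rho> p = relation_ideal Q \<rho> +>\<^bsub>path_algebra Q\<^esub> Poly_Mapping.single p 1"

section \<open>String algebras\<close>

text \<open>\<open>kQ/(\<rho>)\<close> is a string algebra; the conditions do not involve the field \<open>k\<close>.\<close>

locale string_algebra = wf_digraph Q
  for Q :: "('v, 'a) pre_digraph" +
  fixes \<rho> :: "('v, 'a) qpath set"
  assumes zero_relations: "\<rho> \<subseteq> {p \<in> qpaths Q. length (snd p) \<ge> 2}"
    and at_most_two_in:
      "v \<in> verts Q \<Longrightarrow> finite {x \<in> arcs Q. head Q x = v} \<and> card {x \<in> arcs Q. head Q x = v} \<le> 2"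
    and at_most_two_out:
      "v \<in> verts Q \<Longrightarrow> finite {x \<in> arcs Q. tail Q x = v} \<and> card {x \<in> arcs Q. tail Q x = v} \<le> 2"
    and at_most_one_left:
      "y \<in> arcs Q \<Longrightarrow> \<exists>\<^sub>\<le>\<^sub>1 x. (head Q x, [x, y]) \<in> qpaths Q - \<rho>"
    and at_most_one_right:
      "y \<in> arcs Q \<Longrightarrow> \<exists>\<^sub>\<le>\<^sub>1 z. (head Q y, [y, z]) \<in> qpaths Q - \<rho>"

section \<open>Modules\<close>

text \<open>
  The underlying abelian group of a module is a whole type.  Over \<open>kQ/(\<rho>)\<close> the \<open>k\<close>-vector space
  structure of a module \<open>M = \<Lambda>M\<close> need not be given separately: \<open>\<lambda> \<in> k\<close> acts on \<open>e\<^sub>v M\<close>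
  as the class of \<open>\<lambda> e\<^sub>v\<close>.
\<close>

definition add_subgroup :: "'m::ab_group_add set \<Rightarrow> bool" where
  "add_subgroup N \<longleftrightarrow> 0 \<in> N \<and> (\<forall>m\<in>N. \<forall>n\<in>N. m - n \<in> N)"

definition left_module :: "('r, 'b) ring_scheme \<Rightarrow> ('r \<Rightarrow> 'm::ab_group_add \<Rightarrow> 'm) \<Rightarrow> bool" where
  "left_module R act \<longleftrightarrow>
     (\<forall>a\<in>carrier R. \<forall>m n. act a (m + n) = act a m + act a n) \<and>
     (\<forall>a\<in>carrier R. \<forall>b\<in>carrier R. \<forall>m. act (a \<oplus>\<^bsub>R\<^esub> b) m = act a m + act b m) \<and>
     (\<forall>a\<in>carrier R. \<forall>b\<in>carrier R. \<forall>m. act (a \<otimes>\<^bsub>R\<^esub> b) m = act a (act b m)) \<and>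
     add_subgroup hull {act a m |a m. a \<in> carrier R} = UNIV"

definition submodule :: "('r, 'b) ring_scheme \<Rightarrow> ('r \<Rightarrow> 'm::ab_group_add \<Rightarrow> 'm) \<Rightarrow> 'm set \<Rightarrow> bool" where
  "submodule R act N \<longleftrightarrow> add_subgroup N \<and> (\<forall>a\<in>carrier R. \<forall>m\<in>N. act a m \<in> N)"

definition fin_gen_submodule ::
  "('r, 'b) ring_scheme \<Rightarrow> ('r \<Rightarrow> 'm::ab_group_add \<Rightarrow> 'm) \<Rightarrow> 'm set \<Rightarrow> bool" where
  "fin_gen_submodule R act N \<longleftrightarrow> (\<exists>S. finite S \<and> N = submodule R act hull S)"

text \<open>In the rest of this theory \<open>act\<close> is the action of \<open>quiver_algebra Q \<rho>\<close> on a module.\<close>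

type_synonym ('v, 'a, 'k, 'm) quiver_action = "(('v, 'a) qpath \<Rightarrow>\<^sub>0 'k) set \<Rightarrow> 'm \<Rightarrow> 'm"

text \<open>The set \<open>e\<^sub>v N\<close>.\<close>

definition vertex_part ::
  "('v, 'a) pre_digraph \<Rightarrow> ('v, 'a) qpath set \<Rightarrow> ('v, 'a, 'k::field, 'm::ab_group_add) quiver_action \<Rightarrow>
   'v \<Rightarrow> 'm set \<Rightarrow> 'm set" where
  "vertex_part Q \<rho> act v N = act (path_class Q \<rho> (v, [])) ` N"

definition finitely_controlled ::
  "('v, 'a) pre_digraph \<Rightarrow> ('v, 'a) qpath set \<Rightarrow> ('v, 'a, 'k::field, 'm::ab_group_add) quiver_action \<Rightarrow> bool"
where
  "finitely_controlled Q \<rho> act \<longleftrightarrow>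
     (\<forall>v\<in>verts Q. \<exists>N. fin_gen_submodule (quiver_algebra Q \<rho>) act N \<and> vertex_part Q \<rho> act v UNIV \<subseteq> N)"

definition pointwise_artinian ::
  "('v, 'a) pre_digraph \<Rightarrow> ('v, 'a) qpath set \<Rightarrow> ('v, 'a, 'k::field, 'm::ab_group_add) quiver_action \<Rightarrow> bool"
where
  "pointwise_artinian Q \<rho> act \<longleftrightarrow>
     (\<forall>N :: nat \<Rightarrow> 'm set. (\<forall>i. submodule (quiver_algebra Q \<rho>) act (N i)) \<and> decseq N \<longrightarrow>
       (\<forall>v\<in>verts Q. \<exists>n. \<forall>i\<ge>n. vertex_part Q \<rho> act v (N i) = vertex_part Q \<rho> act v (N n)))"

section \<open>Words and their relations\<close>

datatype 'a letter = Direct 'a | Inverse 'a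

primrec letter_arrow :: "'a letter \<Rightarrow> 'a" where
  "letter_arrow (Direct x) = x"
| "letter_arrow (Inverse x) = x"

primrec letter_inv :: "'a letter \<Rightarrow> 'a letter" where
  "letter_inv (Direct x) = Inverse x"
| "letter_inv (Inverse x) = Direct x"

primrec letter_head :: "('v, 'a) pre_digraph \<Rightarrow> 'a letter \<Rightarrow> 'v" where
  "letter_head Q (Direct x) = head Q x"
| "letter_head Q (Inverse x) = tail Q x"

definition letter_tail :: "('v, 'a) pre_digraph \<Rightarrow> 'a letter \<Rightarrow> 'v" where
  "letter_tail Q l = letter_head Q (letter_inv l)"

text \<open>Indices start at 0: the letter \<open>C\<^sub>i\<close> (\<open>i \<ge> 1\<close>) of the word \<open>C\<^sub>1 C\<^sub>2 C\<^sub>3 \<dots>\<close> is \<open>C (i - 1)\<close>.\<close>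

definition N_word :: "('v, 'a) pre_digraph \<Rightarrow> ('v, 'a) qpath set \<Rightarrow> (nat \<Rightarrow> 'a letter) \<Rightarrow> bool" where
  "N_word Q \<rho> C \<longleftrightarrow>
     (\<forall>i. letter_arrow (C i) \<in> arcs Q) \<and>
     (\<forall>i. letter_tail Q (C i) = letter_head Q (C (Suc i))) \<and>
     (\<forall>i. letter_inv (C i) \<noteq> C (Suc i)) \<and>
     (\<forall>(v, xs)\<in>\<rho>. \<forall>i.
        map C [i..<i + length xs] \<noteq> map Direct xs \<and>
        map C [i..<i + length xs] \<noteq> map Inverse (rev xs))"

text \<open>
  A finite word is given, like a path, by its head and its list of letters; the head matters
  for trivial words only.
\<close>

definition initial_word :: "('v, 'a) pre_digraph \<Rightarrow> (nat \<Rightarrow> 'a letter) \<Rightarrow> nat \<Rightarrow> 'v \<times> 'a letter list" where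
  "initial_word Q C n = (letter_head Q (C 0), map C [0..<n])"

fun word_tail :: "('v, 'a) pre_digraph \<Rightarrow> 'v \<times> 'a letter list \<Rightarrow> 'v" where
  "word_tail Q (v, D) = (if D = [] then v else letter_tail Q (last D))"

text \<open>
  The graph of the action of an arrow \<open>x\<close> with tail \<open>u\<close> and head \<open>v\<close> is a relation from
  \<open>e\<^sub>u M\<close> to \<open>e\<^sub>v M\<close>, and \<open>R `` H\<close> is the set written \<open>R H\<close> for linear relations.
  For the composite of relations \<open>R\<close> and \<open>S\<close> in which \<open>S\<close> is applied first, written \<open>R S\<close> like the
  concatenation of words, the library notation is \<open>S O R\<close>.
\<close>

primrec letter_rel ::
  "('v, 'a) pre_digraph \<Rightarrow> ('v, 'a) qpath set \<Rightarrow> ('v, 'a, 'k::field, 'm::ab_group_add) quiver_action \<Rightarrow>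
   'a letter \<Rightarrow> ('m \<times> 'm) set" where
  "letter_rel Q \<rho> act (Direct x) =
     {(m, act (path_class Q \<rho> (head Q x, [x])) m) |m. m \<in> vertex_part Q \<rho> act (tail Q x) UNIV}"
| "letter_rel Q \<rho> act (Inverse x) =
     {(m, act (path_class Q \<rho> (head Q x, [x])) m) |m. m \<in> vertex_part Q \<rho> act (tail Q x) UNIV}\<inverse>"

fun word_rel ::
  "('v, 'a) pre_digraph \<Rightarrow> ('v, 'a) qpath set \<Rightarrow> ('v, 'a, 'k::field, 'm::ab_group_add) quiver_action \<Rightarrow>
   'v \<times> 'a letter list \<Rightarrow> ('m \<times> 'm) set" where
  "word_rel Q \<rho> act (v, []) = Id_on (vertex_part Q \<rho> act v UNIV)"
| "word_rel Q \<rho> act (v, l # D) = word_rel Q \<rho> act (letter_tail Q l, D) O letter_rel Q \<rho> act l"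

text \<open>The set \<open>D M = D (e\<^sub>u M)\<close>, where \<open>u\<close> is the tail of the finite word \<open>D\<close>.\<close>

definition word_image ::
  "('v, 'a) pre_digraph \<Rightarrow> ('v, 'a) qpath set \<Rightarrow> ('v, 'a, 'k::field, 'm::ab_group_add) quiver_action \<Rightarrow>
   'v \<times> 'a letter list \<Rightarrow> 'm set" where
  "word_image Q \<rho> act D = word_rel Q \<rho> act D `` vertex_part Q \<rho> act (word_tail Q D) UNIV"

text \<open>The set \<open>C\<^sup>+(M)\<close>.\<close>

definition word_plus ::
  "('v, 'a) pre_digraph \<Rightarrow> ('v, 'a) qpath set \<Rightarrow> ('v, 'a, 'k::field, 'm::ab_group_add) quiver_action \<Rightarrow>
   (nat \<Rightarrow> 'a letter) \<Rightarrow> 'm set" where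
  "word_plus Q \<rho> act C =
     {m. \<exists>s. s 0 = m \<and> (\<forall>n. s n \<in> letter_rel Q \<rho> act (C n) `` {s (Suc n)})}"

end

theory Submission
  imports Defs
begin

text \<open>
  Only the step \<open>C = x D\<close> with \<open>x\<close> a direct letter needs work: given \<open>m\<close> in all \<open>C\<^sub>\<le>\<^sub>n M\<close>, the preimages of \<open>m\<close>
  under \<open>x\<close> in \<open>D\<^sub>\<le>\<^sub>n M\<close> are a descending chain of nonempty cosets of \<open>U\<^sub>n = ker x \<inter> D\<^sub>\<le>\<^sub>n M\<close>, so it suffices that
  the \<open>U\<^sub>n\<close> stabilize.  If \<open>D\<close> has only inverse letters then \<open>D\<^sub>\<le>\<^sub>n M = e\<^sub>u M\<close> for all \<open>n\<close>.  Otherwise, if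
  \<open>D\<close> has its first direct letter after \<open>k\<close> inverse ones, every path of length \<open>k + 1\<close> kills
  \<open>U\<^sub>k\<^sub>+\<^sub>1\<close>, and it suffices that the part of \<open>e\<^sub>u M\<close> killed by all paths of length \<open>j\<close> satisfies
  the descending chain condition on subspaces.  Applying the arrows out of \<open>u\<close> reduces this to the
  socle of \<open>M\<close> at \<open>u\<close>.  Subspaces of the socle at \<open>u\<close> are submodules, which settles the pointwise
  artinian case.  In the finitely controlled case \<open>e\<^sub>u M\<close> is finitely generated over \<open>k[T]\<close>, where
  \<open>T\<close> is the sum of the primitive cycles at \<open>u\<close>, and \<open>T\<close> kills the socle.
\<close>

section \<open>Descending chain conditions in vector spaces\<close>

locale scalar_space = vector_space scale
  for scale :: "'k::field \<Rightarrow> 'm::ab_group_add \<Rightarrow> 'm"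
begin

text \<open>Only the members of the chain are subspaces; \<open>X\<close> is an arbitrary set, so
  the condition passes to every subset of \<open>X\<close>.\<close>

definition dcc :: "'m set \<Rightarrow> bool" where
  "dcc X \<longleftrightarrow> (\<forall>N :: nat \<Rightarrow> 'm set. decseq N \<and> (\<forall>i. subspace (N i)) \<and> N 0 \<subseteq> X \<longrightarrow>
     (\<exists>n. \<forall>i\<ge>n. N i = N n))"

lemma dccD:
  assumes "dcc X" "decseq N" "\<And>i. subspace (N i)" "N 0 \<subseteq> X"
  obtains n where "\<And>i. i \<ge> n \<Longrightarrow> N i = N n"
  using assms unfolding dcc_def by blast

lemma dcc_mono: "dcc X \<Longrightarrow> Y \<subseteq> X \<Longrightarrow> dcc Y"
  unfolding dcc_def by (meson order_trans)

text \<open>Among maximal independent sets \<open>B i\<close> of the \<open>N i\<close> take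
  \<open>B m\<close> of least size. A vector of \<open>N m\<close> outside \<open>span (B i)\<close>
  with \<open>i \<ge> m\<close> would extend \<open>B i\<close> to an independent subset of
  \<open>N m\<close> larger than \<open>B m\<close>.\<close>

lemma dcc_bounded:
  assumes bd: "\<And>B. B \<subseteq> X \<Longrightarrow> independent B \<Longrightarrow> finite B \<and> card B \<le> n"
  shows "dcc X"
  unfolding dcc_def
proof (intro allI impI, elim conjE)
  fix N :: "nat \<Rightarrow> 'm set"
  assume dec: "decseq N" and sub: "\<forall>i. subspace (N i)" and N0: "N 0 \<subseteq> X"
  have NX: "N i \<subseteq> X" for i
    using decseqD[OF dec le0[of i]] N0 by blast
  have "\<forall>i. \<exists>B. B \<subseteq> N i \<and> independent B \<and> N i \<subseteq> span B"
    by (rule allI, rule maximal_independent_subset) blast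
  from choice[OF this] obtain B
    where B: "\<And>i. B i \<subseteq> N i" "\<And>i. independent (B i)" "\<And>i. N i \<subseteq> span (B i)"
    by blast
  have fin: "finite (B i)" for i
    using bd[OF _ B(2)] B(1) NX by blast
  obtain m where m: "\<And>i. card (B m) \<le> card (B i)"
    using ex_has_least_nat[of "\<lambda>_. True" _ "\<lambda>i. card (B i)"] by blast
  have "N i = N m" if "i \<ge> m" for i
  proof
    show "N i \<subseteq> N m"
      using dec that by (simp add: decseqD)
    show "N m \<subseteq> N i"
    proof
      fix x assume x: "x \<in> N m"
      have "x \<in> span (B i)"
      proof (rule ccontr)
        assume "x \<notin> span (B i)"
        then have ind: "independent (insert x (B i))" and "x \<notin> B i"
          using B independent_insertI span_base by blast+
        have "insert x (B i) \<subseteq> span (B m)"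
          using x B dec that decseqD by blast
        from independent_span_bound[OF fin ind this] \<open>x \<notin> B i\<close> fin m[of i]
        show False by simp
      qed
      then show "x \<in> N i"
        using B(1) sub span_minimal by blast
    qed
  qed
  then show "\<exists>n. \<forall>i\<ge>n. N i = N n" by blast
qed

text \<open>A chain stabilizes once its images and its parts in the kernel do: a vector of the
  larger term differs from one of the smaller term with the same image by an element of the kernel,
  which lies in both terms.\<close>

lemma dcc_extension:
  assumes f: "Vector_Spaces.linear scale scale f"
    and ker: "dcc {x \<in> X. f x = 0}" and im: "dcc (f ` X)"
  shows "dcc X"
  unfolding dcc_def
proof (intro allI impI, elim conjE)
  interpret f: Vector_Spaces.linear scale scale f by fact
  fix N :: "nat \<Rightarrow> 'm set"
  assume dec: "decseq N" and sub: "\<forall>i. subspace (N i)" and N0: "N 0 \<subseteq> X"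
  let ?K = "\<lambda>i. {x \<in> N i. f x = 0}" and ?I = "\<lambda>i. f ` N i"
  have subK: "subspace (?K i)" for i
  proof -
    have "?K i = N i \<inter> {x. f x = 0}" by auto
    then show ?thesis
      using sub f.subspace_kernel by (simp add: subspace_inter)
  qed
  have "decseq ?K"
    using dec unfolding decseq_def by blast
  from dccD[OF ker this subK] obtain n1 where n1: "\<And>i. i \<ge> n1 \<Longrightarrow> ?K i = ?K n1"
    using N0 by blast
  have subI: "subspace (?I i)" for i
    using sub f.subspace_image by blast
  have "decseq ?I"
    using dec unfolding decseq_def by blast
  from dccD[OF im this subI] obtain n2 where n2: "\<And>i. i \<ge> n2 \<Longrightarrow> ?I i = ?I n2"
    using N0 by blast
  let ?n = "max n1 n2"
  have "N i = N ?n" if "i \<ge> ?n" for i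
  proof
    show "N i \<subseteq> N ?n"
      using dec that by (simp add: decseqD)
    show "N ?n \<subseteq> N i"
    proof
      fix x assume x: "x \<in> N ?n"
      have "?I ?n = ?I i"
        using n2[of i] n2[of ?n] that by simp
      with x obtain y where y: "y \<in> N i" "f y = f x"
        by (metis (no_types, lifting) imageE imageI)
      then have "x - y \<in> ?K ?n"
        using x sub \<open>N i \<subseteq> N ?n\<close> by (auto simp: f.diff intro: subspace_diff)
      moreover have "?K ?n = ?K i"
        using n1[of i] n1[of ?n] that by simp
      ultimately have "x - y \<in> N i"
        by blast
      then have "x - y + y \<in> N i"
        using y(1) sub subspace_add by blast
      then show "x \<in> N i" by simp
    qed
  qed
  then show "\<exists>n. \<forall>i\<ge>n. N i = N n" by blast
qed

text \<open>Splits off one map at a time with \<open>dcc_extension\<close>, each time replacing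
  \<open>X\<close> by its part in the kernel; the common kernel remains at the end.\<close>

lemma dcc_kernels:
  assumes "finite A"
    and "\<And>a. a \<in> A \<Longrightarrow> Vector_Spaces.linear scale scale (f a)"
    and "\<And>a. a \<in> A \<Longrightarrow> dcc (f a ` X)"
    and "dcc {x \<in> X. \<forall>a\<in>A. f a x = 0}"
  shows "dcc X"
  using assms
proof (induction A arbitrary: X)
  case empty
  then show ?case by simp
next
  case (insert a A)
  have "dcc {x \<in> X. f a x = 0}"
  proof (rule insert.IH)
    show "dcc (f b ` {x \<in> X. f a x = 0})" if "b \<in> A" for b
      using insert.prems(2)[of b] that by (auto elim: dcc_mono)
    have "{x \<in> {x \<in> X. f a x = 0}. \<forall>b\<in>A. f b x = 0} = {x \<in> X. \<forall>b\<in>insert a A. f b x = 0}"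
      by auto
    then show "dcc {x \<in> {x \<in> X. f a x = 0}. \<forall>b\<in>A. f b x = 0}"
      using insert.prems(3) by simp
  qed (use insert.prems in auto)
  then show ?case
    by (rule dcc_extension[of "f a", rotated]) (simp_all add: insert.prems)
qed

lemma span_UN_incseq:
  assumes "incseq A" "x \<in> span (\<Union>n. A n)"
  obtains n where "x \<in> span (A n)"
proof -
  have mono: "span (A m) \<subseteq> span (A n)" if "m \<le> n" for m n
    using that by (intro span_mono incseqD[OF assms(1)])
  have "span (\<Union>n. A n) \<subseteq> {x. \<exists>n. x \<in> span (A n)}"
  proof (rule span_minimal)
    show "(\<Union>n. A n) \<subseteq> {x. \<exists>n. x \<in> span (A n)}"
      by (auto intro: span_base)
    show "subspace {x. \<exists>n. x \<in> span (A n)}"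
    proof (rule subspaceI)
      fix x y assume "x \<in> {x. \<exists>n. x \<in> span (A n)}" "y \<in> {x. \<exists>n. x \<in> span (A n)}"
      then obtain m n where "x \<in> span (A m)" "y \<in> span (A n)" by blast
      then have "x + y \<in> span (A (max m n))"
        using mono[of m "max m n"] mono[of n "max m n"] by (intro span_add) auto
      then show "x + y \<in> {x. \<exists>n. x \<in> span (A n)}" by blast
    qed (auto intro: span_zero span_scale)
  qed
  then show thesis
    using assms(2) that by blast
qed

text \<open>
  If \<open>H\<^sub>n\<close> is spanned by the \<open>T\<^sup>i B\<close> with \<open>i \<le> n\<close>, then \<open>H\<^sub>n\<^sub>+\<^sub>1 = span B + T H\<^sub>n\<close>, so that the
  rank of \<open>T\<close> on \<open>H\<^sub>n\<close> is at least \<open>dim H\<^sub>n - |B|\<close>.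
\<close>

lemma dcc_kernel_fin_gen:
  assumes T: "Vector_Spaces.linear scale scale T" and B: "finite B"
  shows "dcc {x \<in> span (\<Union>i. (T ^^ i) ` B). T x = 0}" (is "dcc ?X")
proof (rule dcc_bounded)
  interpret T: Vector_Spaces.linear scale scale T by fact
  let ?H = "\<lambda>n. span (\<Union>i\<le>n. (T ^^ i) ` B)"
  fix A assume AX: "A \<subseteq> ?X" and indA: "independent A"
  show "finite A \<and> card A \<le> card B"
  proof (rule ccontr)
    assume "\<not> (finite A \<and> card A \<le> card B)"
    then have "\<exists>A'\<subseteq>A. finite A' \<and> card A' = Suc (card B)"
      using infinite_arbitrarily_large[of A] obtain_subset_with_card_n[of "Suc (card B)" A]
      by (metis not_less_eq_eq)
    then obtain A' where A': "A' \<subseteq> A" "finite A'" "card A' = Suc (card B)" by blast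
    have mono: "?H m \<subseteq> ?H n" if "m \<le> n" for m n
      using that by (intro span_mono UN_mono) auto
    have "incseq (\<lambda>n. \<Union>i\<le>n. (T ^^ i) ` B)"
      unfolding incseq_def by fastforce
    moreover have "(\<Union>i. (T ^^ i) ` B) = (\<Union>n. \<Union>i\<le>n. (T ^^ i) ` B)"
      by blast
    ultimately have "\<forall>x\<in>A'. \<exists>n. x \<in> ?H n"
      using A' AX span_UN_incseq[of "\<lambda>n. \<Union>i\<le>n. (T ^^ i) ` B"]
      by (metis (no_types, lifting) mem_Collect_eq subsetD)
    then obtain g where g: "\<And>x. x \<in> A' \<Longrightarrow> x \<in> ?H (g x)" by metis
    define n where "n = Max (g ` A')"
    have A'H: "A' \<subseteq> ?H n"
    proof
      fix x assume "x \<in> A'"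
      then have "g x \<le> n" using A' by (simp add: n_def)
      then show "x \<in> ?H n" using mono g \<open>x \<in> A'\<close> by blast
    qed
    have "independent A'"
      using indA A' independent_mono by blast
    from maximal_independent_subset_extend[OF A'H this]
    obtain D where D: "A' \<subseteq> D" "D \<subseteq> ?H n" "independent D" "?H n \<subseteq> span D" by blast
    have "finite (\<Union>i\<le>n. (T ^^ i) ` B)" using B by auto
    from independent_span_bound[OF this D(3,2)] have finD: "finite D" by simp
    \<comment> \<open>\<open>T\<close> kills \<open>A'\<close>, so the span of \<open>?E\<close>
      contains \<open>?H (Suc n)\<close> and hence the independent set \<open>D\<close>. But
      \<open>?E\<close> has at most \<open>card B + card D - card A'\<close> elements, which is
      \<open>card D - 1\<close>.\<close>
    let ?E = "B \<union> T ` (D - A')"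
    have TD: "T x \<in> span ?E" if "x \<in> ?H n" for x
    proof -
      have "T x \<in> T ` span D" using D that by blast
      then have "T x \<in> span (T ` D)" by (simp add: T.span_image)
      moreover have "T ` D \<subseteq> span ?E"
      proof
        fix y assume "y \<in> T ` D"
        then obtain d where d: "d \<in> D" "y = T d" by blast
        show "y \<in> span ?E"
        proof (cases "d \<in> A'")
          case True
          then have "y = 0" using d A' AX by auto
          then show ?thesis by (simp add: span_zero)
        next
          case False
          then show ?thesis using d by (intro span_base) auto
        qed
      qed
      ultimately show ?thesis
        using span_minimal[OF _ subspace_span] by blast
    qed
    have "(T ^^ i) b \<in> span ?E" if "i \<le> Suc n" "b \<in> B" for i b
    proof (cases i)
      case 0
      then show ?thesis using that by (auto intro: span_base)
    next
      case (Suc j)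
      then have "(T ^^ j) b \<in> ?H n" using that by (intro span_base) auto
      then show ?thesis using TD Suc by simp
    qed
    then have "?H (Suc n) \<subseteq> span ?E"
      by (intro span_minimal) auto
    then have "D \<subseteq> span ?E" using D mono[of n "Suc n"] by auto
    moreover have "finite ?E" using B finD by simp
    ultimately have "card D \<le> card ?E"
      using independent_span_bound[OF _ D(3)] by blast
    also have "\<dots> \<le> card B + card (D - A')"
      using card_Un_le[of B "T ` (D - A')"] card_image_le[of "D - A'" T] finD by simp
    also have "card (D - A') = card D - card A'"
      using A' D by (simp add: card_Diff_subset)
    finally show False
      using A' D finD card_mono[of D A'] by simp
  qed
qed

end

section \<open>The quotient of a path algebra\<close>

lemma poly_mapping_eq_sum_single:
  fixes f :: "'b \<Rightarrow>\<^sub>0 'c::comm_monoid_add"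
  shows "f = (\<Sum>p\<in>Poly_Mapping.keys f. Poly_Mapping.single p (Poly_Mapping.lookup f p))"
  by (rule poly_mapping_eqI) (auto simp: lookup_sum lookup_single when_def in_keys_iff)

text \<open>The sums in \<open>path_mult\<close> run over supports, which change under addition.
  Common finite index sets make the product additive in each factor.\<close>

lemma path_mult_superset:
  fixes a b :: "('v, 'a) qpath \<Rightarrow>\<^sub>0 'k::field"
  assumes A: "finite A" "Poly_Mapping.keys a \<subseteq> A" and B: "finite B" "Poly_Mapping.keys b \<subseteq> B"
  shows "path_mult Q a b = (\<Sum>p\<in>A. \<Sum>q\<in>B.
     if qpath_tail Q p = fst q
     then Poly_Mapping.single (fst p, snd p @ snd q)
            (Poly_Mapping.lookup a p * Poly_Mapping.lookup b q)
     else 0)"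
  unfolding path_mult_def
proof (rule sum.mono_neutral_cong_left)
  show "\<forall>p\<in>A - Poly_Mapping.keys a. (\<Sum>q\<in>B. if qpath_tail Q p = fst q
     then Poly_Mapping.single (fst p, snd p @ snd q)
            (Poly_Mapping.lookup a p * Poly_Mapping.lookup b q) else 0) = 0"
    by (auto simp: in_keys_iff intro!: sum.neutral)
  show "(\<Sum>q\<in>Poly_Mapping.keys b. if qpath_tail Q p = fst q
     then Poly_Mapping.single (fst p, snd p @ snd q)
            (Poly_Mapping.lookup a p * Poly_Mapping.lookup b q) else 0) =
     (\<Sum>q\<in>B. if qpath_tail Q p = fst q
     then Poly_Mapping.single (fst p, snd p @ snd q)
            (Poly_Mapping.lookup a p * Poly_Mapping.lookup b q) else 0)" for p
    using B by (intro sum.mono_neutral_left) (auto simp: in_keys_iff)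
qed (use A in auto)

lemma path_mult_add_left:
  fixes a b c :: "('v, 'a) qpath \<Rightarrow>\<^sub>0 'k::field"
  shows "path_mult Q (a + b) c = path_mult Q a c + path_mult Q b c"
  using path_mult_superset[of "Poly_Mapping.keys a \<union> Poly_Mapping.keys b" _ "Poly_Mapping.keys c" c Q]
    keys_add[of a b]
  by (auto simp: lookup_add distrib_right single_add simp flip: sum.distrib intro!: sum.cong)

lemma path_mult_add_right:
  fixes a b c :: "('v, 'a) qpath \<Rightarrow>\<^sub>0 'k::field"
  shows "path_mult Q a (b + c) = path_mult Q a b + path_mult Q a c"
  using path_mult_superset[of "Poly_Mapping.keys a" a "Poly_Mapping.keys b \<union> Poly_Mapping.keys c" _ Q]
    keys_add[of b c]
  by (auto simp: lookup_add distrib_left single_add simp flip: sum.distrib intro!: sum.cong)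

lemma path_mult_single:
  "path_mult Q (Poly_Mapping.single p \<alpha>) (Poly_Mapping.single q \<beta>) =
     (if qpath_tail Q p = fst q then Poly_Mapping.single (fst p, snd p @ snd q) (\<alpha> * \<beta>) else 0)"
  using path_mult_superset[of "{p}" "Poly_Mapping.single p \<alpha>" "{q}" "Poly_Mapping.single q \<beta>" Q]
  by simp

lemma qpaths_append:
  assumes "p \<in> qpaths Q" "q \<in> qpaths Q" "qpath_tail Q p = fst q"
  shows "(fst p, snd p @ snd q) \<in> qpaths Q"
  using assms by (cases p; cases q) (auto simp: qpaths_def successively_append_iff hd_append split: if_splits)

lemma path_mult_closed:
  assumes "Poly_Mapping.keys a \<subseteq> qpaths Q" "Poly_Mapping.keys b \<subseteq> qpaths Q"
  shows "Poly_Mapping.keys (path_mult Q a b) \<subseteq> qpaths Q"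
proof -
  have "Poly_Mapping.keys (if qpath_tail Q p = fst q
     then Poly_Mapping.single (fst p, snd p @ snd q)
            (Poly_Mapping.lookup a p * Poly_Mapping.lookup b q) else 0) \<subseteq> qpaths Q"
    if "p \<in> Poly_Mapping.keys a" "q \<in> Poly_Mapping.keys b" for p q
    using assms that qpaths_append[of p Q q] by auto
  then show ?thesis
    unfolding path_mult_def
    by (intro order_trans[OF keys_sum] UN_least) blast
qed

lemma path_algebra_simps [simp]:
  "carrier (path_algebra Q) = {a. Poly_Mapping.keys a \<subseteq> qpaths Q}"
  "a \<otimes>\<^bsub>path_algebra Q\<^esub> b = path_mult Q a b"
  "a \<oplus>\<^bsub>path_algebra Q\<^esub> b = a + b"
  "\<zero>\<^bsub>path_algebra Q\<^esub> = 0"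
  by (simp_all add: path_algebra_def)

section \<open>Two-sided ideals of the path algebra\<close>

lemma path_algebra_abelian_group: "abelian_group (path_algebra Q :: (('v, 'a) qpath \<Rightarrow>\<^sub>0 'k::field) ring)"
proof (rule abelian_groupI)
  fix x y :: "('v, 'a) qpath \<Rightarrow>\<^sub>0 'k"
  assume x: "x \<in> carrier (path_algebra Q)" 
  then show "\<exists>y\<in>carrier (path_algebra Q). y \<oplus>\<^bsub>path_algebra Q\<^esub> x = \<zero>\<^bsub>path_algebra Q\<^esub>"
    by (intro bexI[of _ "- x"]) auto
  assume "y \<in> carrier (path_algebra Q)"
  with x show "x \<oplus>\<^bsub>path_algebra Q\<^esub> y \<in> carrier (path_algebra Q)"
    using keys_add[of x y] by auto
qed (auto simp: add_ac)

lemma two_sided_ideal_Inter: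
  assumes "\<And>I. I \<in> T \<Longrightarrow> two_sided_ideal R I" "T \<noteq> {}" "abelian_group R"
  shows "two_sided_ideal R (\<Inter>T)"
proof -
  interpret abelian_group R by fact
  have "subgroup I (add_monoid R)" if "I \<in> T" for I
    using assms(1)[OF that] by (simp add: two_sided_ideal_def additive_subgroup_def)
  then have "subgroup (\<Inter>T) (add_monoid R)"
    using assms(2) add.subgroups_Inter[of T] by blast
  then have "additive_subgroup (\<Inter>T) R"
    by (rule additive_subgroupI)
  then show ?thesis
    using assms(1) by (auto simp: two_sided_ideal_def)
qed

lemma two_sided_ideal_carrier:
  "two_sided_ideal (path_algebra Q) (carrier (path_algebra Q :: (('v, 'a) qpath \<Rightarrow>\<^sub>0 'k::field) ring))"
proof -
  interpret abelian_group "path_algebra Q :: (('v, 'a) qpath \<Rightarrow>\<^sub>0 'k) ring"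
    by (rule path_algebra_abelian_group)
  have "subgroup (carrier (path_algebra Q :: (('v, 'a) qpath \<Rightarrow>\<^sub>0 'k) ring)) (add_monoid (path_algebra Q))"
    using add.subgroup_self by simp
  then show ?thesis
    unfolding two_sided_ideal_def
    by (auto intro!: additive_subgroupI dest: path_mult_closed[THEN subsetD, rotated -1])
qed

text \<open>The hull is an intersection of ideals, hence an ideal as soon as some ideal contains
  \<open>\<rho>\<close>; the whole algebra is one because \<open>\<rho>\<close> consists of
  paths.\<close>

lemma relation_ideal_two_sided:
  assumes "\<rho> \<subseteq> qpaths Q"
  shows "two_sided_ideal (path_algebra Q) (relation_ideal Q \<rho> :: (('v, 'a) qpath \<Rightarrow>\<^sub>0 'k::field) set)"
  unfolding relation_ideal_def hull_def
proof (rule two_sided_ideal_Inter)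
  have "(\<lambda>r. Poly_Mapping.single r 1) ` \<rho> \<subseteq> carrier (path_algebra Q :: (('v, 'a) qpath \<Rightarrow>\<^sub>0 'k) ring)"
    using assms by auto
  then show "{t :: (('v, 'a) qpath \<Rightarrow>\<^sub>0 'k) set. two_sided_ideal (path_algebra Q) t \<and>
      (\<lambda>r. Poly_Mapping.single r 1) ` \<rho> \<subseteq> t} \<noteq> {}"
    using two_sided_ideal_carrier by blast
qed (use path_algebra_abelian_group in auto)

lemma relation_ideal_superset:
  "r \<in> \<rho> \<Longrightarrow> Poly_Mapping.single r 1 \<in> (relation_ideal Q \<rho> :: (('v, 'a) qpath \<Rightarrow>\<^sub>0 'k::field) set)"
  unfolding relation_ideal_def by (intro hull_inc) auto

definition alg_class ::
  "('v, 'a) pre_digraph \<Rightarrow> ('v, 'a) qpath set \<Rightarrow> (('v, 'a) qpath \<Rightarrow>\<^sub>0 'k::field) \<Rightarrow> (('v, 'a) qpath \<Rightarrow>\<^sub>0 'k) set" where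
  "alg_class Q \<rho> a = relation_ideal Q \<rho> +>\<^bsub>path_algebra Q\<^esub> a"

context
  fixes Q :: "('v, 'a) pre_digraph" and \<rho> :: "('v, 'a) qpath set"
  assumes \<rho>: "\<rho> \<subseteq> qpaths Q"
begin

lemma relation_ideal_abelian_subgroup:
  "abelian_subgroup (relation_ideal Q \<rho> :: (('v, 'a) qpath \<Rightarrow>\<^sub>0 'k::field) set) (path_algebra Q)"
  using relation_ideal_two_sided[OF \<rho>] path_algebra_abelian_group
  by (intro abelian_subgroupI3) (auto simp: two_sided_ideal_def)

lemma carrier_quiver_algebra:
  "carrier (quiver_algebra Q \<rho> :: (('v, 'a) qpath \<Rightarrow>\<^sub>0 'k::field) set ring) =
     alg_class Q \<rho> ` {a. Poly_Mapping.keys a \<subseteq> qpaths Q}"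
  unfolding quiver_algebra_def FactRing_def A_RCOSETS_def' alg_class_def by auto

lemma alg_class_add:
  fixes a b :: "('v, 'a) qpath \<Rightarrow>\<^sub>0 'k::field"
  assumes "Poly_Mapping.keys a \<subseteq> qpaths Q" "Poly_Mapping.keys b \<subseteq> qpaths Q"
  shows "alg_class Q \<rho> a \<oplus>\<^bsub>quiver_algebra Q \<rho>\<^esub> alg_class Q \<rho> b = alg_class Q \<rho> (a + b)"
  using abelian_subgroup.a_rcos_sum[OF relation_ideal_abelian_subgroup, of a b] assms
  by (simp add: quiver_algebra_def FactRing_def alg_class_def)

lemma alg_class_relation:
  assumes "r \<in> \<rho>"
  shows "alg_class Q \<rho> (Poly_Mapping.single r 1) = (alg_class Q \<rho> 0 :: (('v, 'a) qpath \<Rightarrow>\<^sub>0 'k::field) set)"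
proof -
  interpret abelian_subgroup "relation_ideal Q \<rho> :: (('v, 'a) qpath \<Rightarrow>\<^sub>0 'k) set" "path_algebra Q"
    by (rule relation_ideal_abelian_subgroup)
  have "(0 :: ('v, 'a) qpath \<Rightarrow>\<^sub>0 'k) \<in> relation_ideal Q \<rho>"
    using additive_subgroup.zero_closed[OF additive_subgroup_axioms] by simp
  then show ?thesis
    unfolding alg_class_def
    by (simp only: a_rcos_const relation_ideal_superset[OF assms])
qed

text \<open>The product of two cosets is a union over all representatives. By \<open>cong\<close>
  every set in the union is the same coset, and by \<open>self\<close> the union is not
  empty.\<close>

lemma alg_class_mult:
  fixes a b :: "('v, 'a) qpath \<Rightarrow>\<^sub>0 'k::field"
  assumes a: "Poly_Mapping.keys a \<subseteq> qpaths Q" and b: "Poly_Mapping.keys b \<subseteq> qpaths Q"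
  shows "alg_class Q \<rho> a \<otimes>\<^bsub>quiver_algebra Q \<rho>\<^esub> alg_class Q \<rho> b = alg_class Q \<rho> (path_mult Q a b)"
proof -
  let ?I = "relation_ideal Q \<rho> :: (('v, 'a) qpath \<Rightarrow>\<^sub>0 'k) set"
  interpret abelian_subgroup ?I "path_algebra Q"
    by (rule relation_ideal_abelian_subgroup)
  have I: "i + j \<in> ?I" "Poly_Mapping.keys i \<subseteq> qpaths Q" if "i \<in> ?I" "j \<in> ?I" for i j
    using additive_subgroup.a_closed[OF additive_subgroup_axioms, of i j] a_subset that by auto
  have mult: "path_mult Q c i \<in> ?I" "path_mult Q i c \<in> ?I"
    if "i \<in> ?I" "Poly_Mapping.keys c \<subseteq> qpaths Q" for c i
    using relation_ideal_two_sided[OF \<rho>] that by (auto simp: two_sided_ideal_def)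
  have cong: "alg_class Q \<rho> (path_mult Q a' b') = alg_class Q \<rho> (path_mult Q a b)"
    if "a' \<in> alg_class Q \<rho> a" "b' \<in> alg_class Q \<rho> b" for a' b'
  proof -
    obtain i j where ij: "i \<in> ?I" "j \<in> ?I" "a' = i + a" "b' = j + b"
      using \<open>a' \<in> alg_class Q \<rho> a\<close> \<open>b' \<in> alg_class Q \<rho> b\<close>
      unfolding alg_class_def a_r_coset_def' by auto
    have eq: "path_mult Q a' b' = (path_mult Q i j + path_mult Q i b + path_mult Q a j) + path_mult Q a b"
      by (simp add: ij path_mult_add_left path_mult_add_right add_ac)
    have "path_mult Q i j + path_mult Q i b + path_mult Q a j \<in> ?I"
      using ij(1,2) a b by (intro I(1) mult) (auto dest: I(2))
    then have "path_mult Q a' b' \<in> ?I +>\<^bsub>path_algebra Q\<^esub> path_mult Q a b"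
      unfolding a_r_coset_def' eq by auto
    then show ?thesis
      unfolding alg_class_def
      using a_repr_independence'[of "path_mult Q a' b'" "path_mult Q a b"] path_mult_closed[OF a b] by simp
  qed
  have self: "a \<in> alg_class Q \<rho> a" "b \<in> alg_class Q \<rho> b"
    using a_rcos_self[of a] a_rcos_self[of b] a b by (simp_all add: alg_class_def)
  have "(\<Union>a'\<in>alg_class Q \<rho> a. \<Union>b'\<in>alg_class Q \<rho> b. alg_class Q \<rho> (path_mult Q a' b')) =
      (\<Union>a'\<in>alg_class Q \<rho> a. \<Union>b'\<in>alg_class Q \<rho> b. alg_class Q \<rho> (path_mult Q a b))"
    using cong by (intro SUP_cong refl) blast
  also have "\<dots> = alg_class Q \<rho> (path_mult Q a b)"
    using self by blast
  finally show ?thesis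
    by (simp add: quiver_algebra_def FactRing_def rcoset_mult_def flip: alg_class_def)
qed

end

section \<open>Modules over a string algebra\<close>

locale string_module = string_algebra Q \<rho>
  for Q :: "('v, 'a) pre_digraph" and \<rho> :: "('v, 'a) qpath set" +
  fixes act :: "('v, 'a, 'k::field, 'm::ab_group_add) quiver_action"
  assumes left_module: "left_module (quiver_algebra Q \<rho>) act"
begin

definition path_act :: "(('v, 'a) qpath \<Rightarrow>\<^sub>0 'k) \<Rightarrow> 'm \<Rightarrow> 'm" where
  "path_act f = act (alg_class Q \<rho> f)"

definition e :: "'v \<Rightarrow> 'm \<Rightarrow> 'm" where
  "e v = path_act (Poly_Mapping.single (v, []) 1)"

definition arr :: "'a \<Rightarrow> 'm \<Rightarrow> 'm" where
  "arr x = path_act (Poly_Mapping.single (head Q x, [x]) 1)"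

definition supp :: "'m \<Rightarrow> 'v set" where
  "supp m = {v \<in> verts Q. e v m \<noteq> 0}"

text \<open>The scalar \<open>c\<close> should act as the sum of all \<open>c e_v\<close>, which is
  no element of the path algebra if there are infinitely many vertices. On \<open>m\<close> only the
  vertices of its support contribute, and these are finite in number.\<close>

definition scale :: "'k \<Rightarrow> 'm \<Rightarrow> 'm" where
  "scale c m = (\<Sum>v\<in>supp m. path_act (Poly_Mapping.single (v, []) c) m)"

text \<open>By condition (b) of a string algebra this relation is a partial injection on the
  arrows.\<close>

definition good :: "'a \<Rightarrow> 'a \<Rightarrow> bool" where
  "good x y \<longleftrightarrow> (head Q x, [x, y]) \<in> qpaths Q - \<rho>"

lemma relations_qpaths: "\<rho> \<subseteq> qpaths Q"
  using zero_relations by auto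

lemma path_act_add_right: "Poly_Mapping.keys f \<subseteq> qpaths Q \<Longrightarrow> path_act f (m + n) = path_act f m + path_act f n"
  using left_module unfolding left_module_def carrier_quiver_algebra[OF relations_qpaths] path_act_def by blast

lemma path_act_add_left:
  "Poly_Mapping.keys f \<subseteq> qpaths Q \<Longrightarrow> Poly_Mapping.keys g \<subseteq> qpaths Q \<Longrightarrow>
   path_act (f + g) m = path_act f m + path_act g m"
  using left_module unfolding left_module_def carrier_quiver_algebra[OF relations_qpaths] path_act_def
  by (simp flip: alg_class_add[OF relations_qpaths])

lemma path_act_mult:
  "Poly_Mapping.keys f \<subseteq> qpaths Q \<Longrightarrow> Poly_Mapping.keys g \<subseteq> qpaths Q \<Longrightarrow>
   path_act f (path_act g m) = path_act (path_mult Q f g) m"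
  using left_module unfolding left_module_def carrier_quiver_algebra[OF relations_qpaths] path_act_def
  by (simp flip: alg_class_mult[OF relations_qpaths])

lemma path_act_zero_left [simp]: "path_act 0 m = 0"
  using path_act_add_left[of 0 0 m] by simp

lemma path_act_zero_right: "Poly_Mapping.keys f \<subseteq> qpaths Q \<Longrightarrow> path_act f 0 = 0"
  using path_act_add_right[of f 0 0] by simp

lemma path_act_sum_right:
  "Poly_Mapping.keys f \<subseteq> qpaths Q \<Longrightarrow> path_act f (sum h A) = (\<Sum>i\<in>A. path_act f (h i))"
  by (induction A rule: infinite_finite_induct) (simp_all add: path_act_zero_right path_act_add_right)

lemma path_act_sum_left:
  "(\<And>i. i \<in> A \<Longrightarrow> Poly_Mapping.keys (f i) \<subseteq> qpaths Q) \<Longrightarrow> path_act (sum f A) m = (\<Sum>i\<in>A. path_act (f i) m)"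
proof (induction A rule: infinite_finite_induct)
  case (insert x F)
  then have "Poly_Mapping.keys (sum f F) \<subseteq> qpaths Q"
    using keys_sum[of f F] by blast
  with insert show ?case
    by (simp add: path_act_add_left)
qed simp_all

lemma path_act_expand:
  assumes "Poly_Mapping.keys f \<subseteq> qpaths Q"
  shows "path_act f m = (\<Sum>p\<in>Poly_Mapping.keys f. path_act (Poly_Mapping.single p (Poly_Mapping.lookup f p)) m)"
proof -
  have "path_act (\<Sum>p\<in>Poly_Mapping.keys f. Poly_Mapping.single p (Poly_Mapping.lookup f p)) m =
      (\<Sum>p\<in>Poly_Mapping.keys f. path_act (Poly_Mapping.single p (Poly_Mapping.lookup f p)) m)"
    using assms by (intro path_act_sum_left) auto
  then show ?thesis
    using poly_mapping_eq_sum_single[of f] by simp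
qed

lemma path_act_single_mult:
  "p \<in> qpaths Q \<Longrightarrow> q \<in> qpaths Q \<Longrightarrow>
   path_act (Poly_Mapping.single p \<alpha>) (path_act (Poly_Mapping.single q \<beta>) m) =
     (if qpath_tail Q p = fst q then path_act (Poly_Mapping.single (fst p, snd p @ snd q) (\<alpha> * \<beta>)) m else 0)"
  by (subst path_act_mult) (auto simp: path_mult_single)

section \<open>Idempotents and the decomposition of the module by vertices\<close>

lemma trivial_qpath: "v \<in> verts Q \<Longrightarrow> (v, []) \<in> qpaths Q"
  by (simp add: qpaths_def)

lemma arrow_qpath: "x \<in> arcs Q \<Longrightarrow> (head Q x, [x]) \<in> qpaths Q"
  by (simp add: qpaths_def)

lemma fst_qpath: "p \<in> qpaths Q \<Longrightarrow> fst p \<in> verts Q"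
  by (auto simp: qpaths_def)

lemma tail_qpath: "p \<in> qpaths Q \<Longrightarrow> qpath_tail Q p \<in> verts Q"
  by (cases p) (auto simp: qpaths_def intro!: tail_in_verts dest: last_in_set)

lemma keys_single_qpath: "p \<in> qpaths Q \<Longrightarrow> Poly_Mapping.keys (Poly_Mapping.single p c) \<subseteq> qpaths Q"
  by simp

lemma e_path_act:
  "v \<in> verts Q \<Longrightarrow> p \<in> qpaths Q \<Longrightarrow>
   e v (path_act (Poly_Mapping.single p c) m) = (if v = fst p then path_act (Poly_Mapping.single p c) m else 0)"
  unfolding e_def by (subst path_act_single_mult) (auto simp: trivial_qpath)

lemma path_act_e:
  "v \<in> verts Q \<Longrightarrow> p \<in> qpaths Q \<Longrightarrow>
   path_act (Poly_Mapping.single p c) (e v m) = (if v = qpath_tail Q p then path_act (Poly_Mapping.single p c) m else 0)"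
  unfolding e_def by (subst path_act_single_mult) (auto simp: trivial_qpath)

lemma e_e: "v \<in> verts Q \<Longrightarrow> w \<in> verts Q \<Longrightarrow> e v (e w m) = (if v = w then e v m else 0)"
  using e_path_act[OF _ trivial_qpath, of v w 1 m] by (auto simp: e_def)

lemma e_add: "v \<in> verts Q \<Longrightarrow> e v (m + n) = e v m + e v n"
  unfolding e_def by (simp add: path_act_add_right trivial_qpath)

lemma e_zero: "v \<in> verts Q \<Longrightarrow> e v 0 = 0"
  unfolding e_def by (simp add: path_act_zero_right trivial_qpath)

lemma e_sum: "v \<in> verts Q \<Longrightarrow> e v (sum h A) = (\<Sum>i\<in>A. e v (h i))"
  unfolding e_def by (simp add: path_act_sum_right trivial_qpath)

lemma e_minus: "v \<in> verts Q \<Longrightarrow> e v (m - n) = e v m - e v n"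
  using e_add[of v "m - n" n] by simp

text \<open>The elements with such a decomposition form an additive subgroup. It contains every
  \<open>act a m\<close>, since each path maps into the part at its head, so the condition
  \<Lambda>M = M gives the claim.\<close>

lemma finite_decomposition: "\<exists>F. finite F \<and> F \<subseteq> verts Q \<and> (\<Sum>v\<in>F. e v m) = m" (is "?P m")
proof -
  \<comment> \<open>Orthogonality of the \<open>e v\<close> makes the new vertices contribute zero,
    so two elements can be decomposed over a common vertex set.\<close>
  have extend: "(\<Sum>v\<in>G. e v m) = m"
    if F: "finite F" "F \<subseteq> G" "finite G" "G \<subseteq> verts Q" "(\<Sum>v\<in>F. e v m) = m" for F G m
  proof -
    have "e w m = 0" if w: "w \<in> G - F" for w
    proof -
      have "e w (\<Sum>v\<in>F. e v m) = (\<Sum>v\<in>F. e w (e v m))"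
        using w \<open>G \<subseteq> verts Q\<close> by (intro e_sum) auto
      also have "\<dots> = 0"
        using w \<open>G \<subseteq> verts Q\<close> \<open>F \<subseteq> G\<close> by (intro sum.neutral) (auto simp: e_e subset_iff)
      finally show ?thesis
        using F(5) by simp
    qed
    then have "(\<Sum>v\<in>F. e v m) = (\<Sum>v\<in>G. e v m)"
      using F by (intro sum.mono_neutral_left) auto
    with F show ?thesis by simp
  qed
  have diff: "?P (m - n)" if P: "?P m" "?P n" for m n
  proof -
    from P obtain F G where F: "finite F" "F \<subseteq> verts Q" "(\<Sum>v\<in>F. e v m) = m"
      and G: "finite G" "G \<subseteq> verts Q" "(\<Sum>v\<in>G. e v n) = n" by blast
    have "(\<Sum>v\<in>F \<union> G. e v m) = m" "(\<Sum>v\<in>F \<union> G. e v n) = n"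
      using F G extend[of F "F \<union> G" m] extend[of G "F \<union> G" n] by auto
    then have "(\<Sum>v\<in>F \<union> G. e v (m - n)) = m - n"
      using F G by (subst sum.cong[OF refl, of _ _ "\<lambda>v. e v m - e v n"])
        (auto simp: e_minus sum_subtractf)
    then show ?thesis
      using F G by (intro exI[of _ "F \<union> G"]) auto
  qed
  have zero: "?P 0"
    by (intro exI[of _ "{}"]) auto
  have plus: "?P (m + n)" if "?P m" "?P n" for m n
    using diff[OF that(1) diff[OF zero that(2)]] by simp
  have sum: "?P (sum h A)" if "finite A" "\<And>i. i \<in> A \<Longrightarrow> ?P (h i)" for h :: "('v, 'a) qpath \<Rightarrow> 'm" and A
    using that
  proof (induction A rule: finite_induct)
    case empty
    then show ?case using zero by simp
  next
    case (insert x F)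
    then have "?P (h x + sum h F)" by (intro plus) auto
    then show ?case using insert.hyps by simp
  qed
  have "m \<in> add_subgroup hull {act a m |a m. a \<in> carrier (quiver_algebra Q \<rho>)}"
    using left_module by (simp add: left_module_def)
  then show ?thesis
  proof (rule hull_induct)
    fix x assume "x \<in> {act a m |a m. a \<in> carrier (quiver_algebra Q \<rho>)}"
    then obtain f n where f: "Poly_Mapping.keys f \<subseteq> qpaths Q" "x = path_act f n"
      unfolding carrier_quiver_algebra[OF relations_qpaths] path_act_def by auto
    have "?P (path_act (Poly_Mapping.single p (Poly_Mapping.lookup f p)) n)" if "p \<in> Poly_Mapping.keys f" for p
    proof -
      have "p \<in> qpaths Q" using f(1) that by blast
      then show ?thesis
        by (intro exI[of _ "{fst p}"]) (simp add: e_path_act fst_qpath)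
    qed
    then show "?P x"
      unfolding f(2) path_act_expand[OF f(1)] by (intro sum) auto
  next
    show "add_subgroup {m. ?P m}"
      unfolding add_subgroup_def using zero diff by blast
  qed
qed

lemma supp_decomposition: "finite (supp m)" "(\<Sum>v\<in>supp m. e v m) = m"
proof -
  obtain F where F: "finite F" "F \<subseteq> verts Q" "(\<Sum>v\<in>F. e v m) = m"
    using finite_decomposition by blast
  have sF: "supp m \<subseteq> F"
  proof
    fix w assume w: "w \<in> supp m"
    then have wv: "w \<in> verts Q" by (simp add: supp_def)
    have "e w m = (\<Sum>v\<in>F. e w (e v m))"
      using F(3) e_sum[OF wv, of "\<lambda>v. e v m" F] by simp
    also have "\<dots> = (\<Sum>v\<in>F. if v = w then e w m else 0)"
      using F(2) wv by (intro sum.cong) (auto simp: e_e subset_iff)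
    finally show "w \<in> F"
      using w F(1) by (auto simp: supp_def split: if_splits)
  qed
  then show "finite (supp m)"
    using F finite_subset by blast
  have "(\<Sum>v\<in>supp m. e v m) = (\<Sum>v\<in>F. e v m)"
    using F sF by (intro sum.mono_neutral_left) (auto simp: supp_def)
  then show "(\<Sum>v\<in>supp m. e v m) = m"
    using F by simp
qed

lemma scale_eq_sum:
  assumes "finite F" "F \<subseteq> verts Q" "supp m \<subseteq> F"
  shows "scale c m = (\<Sum>v\<in>F. path_act (Poly_Mapping.single (v, []) c) m)"
  unfolding scale_def
proof (rule sum.mono_neutral_left)
  show "\<forall>v\<in>F - supp m. path_act (Poly_Mapping.single (v, []) c) m = 0"
  proof
    fix v assume v: "v \<in> F - supp m"
    then have "v \<in> verts Q" "e v m = 0"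
      using assms by (auto simp: supp_def)
    then show "path_act (Poly_Mapping.single (v, []) c) m = 0"
      using path_act_e[of v "(v, [])" c m] by (simp add: trivial_qpath path_act_zero_right)
  qed
qed (use assms in auto)

lemma supp_verts: "supp m \<subseteq> verts Q"
  by (auto simp: supp_def)

sublocale scalar_space scale
proof unfold_locales
  fix a b :: 'k and m n :: 'm
  have fin: "finite (supp m)" for m
    by (rule supp_decomposition)
  let ?F = "supp m \<union> supp n \<union> supp (m + n)"
  have "finite ?F" "?F \<subseteq> verts Q"
    using fin supp_verts by auto
  then show "scale a (m + n) = scale a m + scale a n"
    using scale_eq_sum[of ?F m a] scale_eq_sum[of ?F n a] scale_eq_sum[of ?F "m + n" a]
    by (auto simp: path_act_add_right trivial_qpath subset_iff simp flip: sum.distrib intro!: sum.cong)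
  show "scale (a + b) m = scale a m + scale b m"
    unfolding scale_def using supp_verts[of m]
    by (auto simp: single_add path_act_add_left trivial_qpath subset_iff simp flip: sum.distrib intro!: sum.cong)
  let ?G = "supp m \<union> supp (scale b m)"
  have G: "finite ?G" "?G \<subseteq> verts Q"
    using fin supp_verts by auto
  have "scale a (scale b m) = (\<Sum>v\<in>?G. path_act (Poly_Mapping.single (v, []) a) (scale b m))"
    using G by (intro scale_eq_sum) auto
  also have "\<dots> = (\<Sum>v\<in>?G. path_act (Poly_Mapping.single (v, []) (a * b)) m)"
  proof (rule sum.cong[OF refl])
    fix v assume v: "v \<in> ?G"
    have "path_act (Poly_Mapping.single (v, []) a) (scale b m) =
        path_act (Poly_Mapping.single (v, []) a) (\<Sum>w\<in>?G. path_act (Poly_Mapping.single (w, []) b) m)"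
      using scale_eq_sum[OF G, of m b] by simp
    also have "\<dots> = (\<Sum>w\<in>?G. path_act (Poly_Mapping.single (v, []) a) (path_act (Poly_Mapping.single (w, []) b) m))"
      using v G by (intro path_act_sum_right keys_single_qpath trivial_qpath) auto
    also have "\<dots> = (\<Sum>w\<in>?G. if w = v then path_act (Poly_Mapping.single (v, []) (a * b)) m else 0)"
      using v G by (intro sum.cong refl, subst path_act_single_mult) (auto simp: trivial_qpath subset_iff)
    also have "\<dots> = path_act (Poly_Mapping.single (v, []) (a * b)) m"
      using v G by simp
    finally show "path_act (Poly_Mapping.single (v, []) a) (scale b m) =
      path_act (Poly_Mapping.single (v, []) (a * b)) m" .
  qed
  also have "\<dots> = scale (a * b) m"
    using G by (intro scale_eq_sum[symmetric]) auto
  finally show "scale a (scale b m) = scale (a * b) m" .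
  show "scale 1 m = m"
    using supp_decomposition(2)[of m] unfolding scale_def e_def .
qed

text \<open>Scaling before the path matters only at its tail, and scaling afterwards
  (\<open>scale_path_act\<close>) only at its head. Both put the coefficient \<open>c\<close> on the
  path, which yields linearity.\<close>

lemma path_act_scale:
  assumes p: "p \<in> qpaths Q"
  shows "path_act (Poly_Mapping.single p 1) (scale c m) = path_act (Poly_Mapping.single p c) m"
proof -
  let ?F = "insert (qpath_tail Q p) (supp m)"
  have F: "finite ?F" "?F \<subseteq> verts Q" "supp m \<subseteq> ?F"
    using supp_decomposition supp_verts tail_qpath[OF p] by auto
  have "path_act (Poly_Mapping.single p 1) (scale c m) =
      (\<Sum>v\<in>?F. path_act (Poly_Mapping.single p 1) (path_act (Poly_Mapping.single (v, []) c) m))"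
    unfolding scale_eq_sum[OF F] by (rule path_act_sum_right[OF keys_single_qpath[OF p]])
  also have "\<dots> = (\<Sum>v\<in>?F. if v = qpath_tail Q p then path_act (Poly_Mapping.single p c) m else 0)"
    using F p by (intro sum.cong refl, subst path_act_single_mult) (auto simp: trivial_qpath subset_iff)
  also have "\<dots> = path_act (Poly_Mapping.single p c) m"
    using F by simp
  finally show ?thesis .
qed

lemma scale_path_act:
  assumes p: "p \<in> qpaths Q"
  shows "scale c (path_act (Poly_Mapping.single p 1) m) = path_act (Poly_Mapping.single p c) m"
proof -
  have "supp (path_act (Poly_Mapping.single p 1) m) \<subseteq> {fst p}"
    using p by (auto simp: supp_def e_path_act split: if_splits)
  then have "scale c (path_act (Poly_Mapping.single p 1) m) =
      path_act (Poly_Mapping.single (fst p, []) c) (path_act (Poly_Mapping.single p 1) m)"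
    using scale_eq_sum[of "{fst p}" _ c] fst_qpath[OF p] by simp
  also have "\<dots> = path_act (Poly_Mapping.single p c) m"
    using p by (subst path_act_single_mult) (auto simp: trivial_qpath fst_qpath)
  finally show ?thesis .
qed

lemma linear_path_act: "p \<in> qpaths Q \<Longrightarrow> Vector_Spaces.linear scale scale (path_act (Poly_Mapping.single p 1))"
  by (unfold_locales) (simp_all add: path_act_add_right path_act_scale scale_path_act)

lemma linear_e: "v \<in> verts Q \<Longrightarrow> Vector_Spaces.linear scale scale (e v)"
  unfolding e_def by (intro linear_path_act trivial_qpath)

lemma linear_arr: "x \<in> arcs Q \<Longrightarrow> Vector_Spaces.linear scale scale (arr x)"
  unfolding arr_def by (intro linear_path_act arrow_qpath)

lemma arr_zero: "x \<in> arcs Q \<Longrightarrow> arr x 0 = 0"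
  unfolding arr_def by (simp add: path_act_zero_right arrow_qpath)

lemma e_arr: "v \<in> verts Q \<Longrightarrow> x \<in> arcs Q \<Longrightarrow> e v (arr x m) = (if v = head Q x then arr x m else 0)"
  unfolding arr_def by (subst e_path_act) (auto simp: arrow_qpath)

lemma arr_e: "v \<in> verts Q \<Longrightarrow> x \<in> arcs Q \<Longrightarrow> arr x (e v m) = (if v = tail Q x then arr x m else 0)"
  unfolding arr_def by (subst path_act_e) (auto simp: arrow_qpath)

text \<open>Either the arrows do not compose and their product is zero in the path algebra, or
  \<open>xy\<close> is a zero relation and its class is zero.\<close>

lemma arr_arr_bad:
  assumes "x \<in> arcs Q" "y \<in> arcs Q" "\<not> good x y"
  shows "arr x (arr y m) = 0"
proof (cases "tail Q x = head Q y")
  case True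
  then have "(head Q x, [x, y]) \<in> \<rho>"
    using assms by (auto simp: good_def qpaths_def)
  then have "path_act (Poly_Mapping.single (head Q x, [x, y]) 1) m = 0"
    using path_act_zero_left[of m] unfolding path_act_def
    by (subst alg_class_relation[OF relations_qpaths])
  then show ?thesis
    unfolding arr_def using assms True by (subst path_act_single_mult) (auto simp: arrow_qpath)
next
  case False
  then show ?thesis
    unfolding arr_def using assms by (subst path_act_single_mult) (auto simp: arrow_qpath)
qed

text \<open>Trivial paths are excluded because the empty list gives the identity on the right, not
  \<open>e v\<close>.\<close>

lemma path_act_word:
  "(v, xs) \<in> qpaths Q \<Longrightarrow> xs \<noteq> [] \<Longrightarrow> path_act (Poly_Mapping.single (v, xs) 1) m = foldr arr xs m"
proof (induction xs arbitrary: v)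
  case Nil
  then show ?case by simp
next
  case (Cons x xs)
  show ?case
  proof (cases "xs = []")
    case True
    then show ?thesis using Cons.prems by (auto simp: arr_def qpaths_def)
  next
    case False
    have x: "x \<in> arcs Q" "v = head Q x" and xs: "(tail Q x, xs) \<in> qpaths Q"
      using Cons.prems False by (auto simp: qpaths_def neq_Nil_conv)
    have "arr x (path_act (Poly_Mapping.single (tail Q x, xs) 1) m) = path_act (Poly_Mapping.single (v, x # xs) 1) m"
      unfolding arr_def using x xs by (subst path_act_single_mult) (auto simp: arrow_qpath)
    then show ?thesis
      using Cons.IH[OF xs False] by simp
  qed
qed

section \<open>Translation of the module notions into \<open>e\<close> and
  \<open>arr\<close>\<close>

lemma vertex_part_eq: "vertex_part Q \<rho> act v N = e v ` N"
  unfolding vertex_part_def e_def path_act_def alg_class_def path_class_def by simp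

lemma letter_rel_eq:
  "letter_rel Q \<rho> act (Direct x) = {(m, arr x m) |m. m \<in> range (e (tail Q x))}"
  "letter_rel Q \<rho> act (Inverse x) = {(arr x m, m) |m. m \<in> range (e (tail Q x))}"
  unfolding letter_rel.simps vertex_part_eq
  by (auto simp: arr_def path_act_def alg_class_def path_class_def)

text \<open>Every path is a trivial path or a product of arrows, and a general element acts as a
  linear combination of paths.\<close>

lemma submoduleI:
  assumes sub: "subspace N"
    and e: "\<And>v m. v \<in> verts Q \<Longrightarrow> m \<in> N \<Longrightarrow> e v m \<in> N"
    and arr: "\<And>x m. x \<in> arcs Q \<Longrightarrow> m \<in> N \<Longrightarrow> arr x m \<in> N"
  shows "submodule (quiver_algebra Q \<rho>) act N"
  unfolding submodule_def
proof (intro conjI ballI)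
  show "add_subgroup N"
    unfolding add_subgroup_def using sub subspace_0 subspace_diff by blast
  have words: "foldr arr xs m \<in> N" if "m \<in> N" "set xs \<subseteq> arcs Q" for xs m
    using that by (induction xs) (auto intro: arr)
  fix a :: "(('v, 'a) qpath \<Rightarrow>\<^sub>0 'k) set" and m
  assume a: "a \<in> carrier (quiver_algebra Q \<rho>)" and m: "m \<in> N"
  then obtain f where f: "Poly_Mapping.keys f \<subseteq> qpaths Q" "a = alg_class Q \<rho> f"
    unfolding carrier_quiver_algebra[OF relations_qpaths] by auto
  have "path_act (Poly_Mapping.single p c) m \<in> N" if "p \<in> qpaths Q" for p c
  proof -
    obtain v xs where p: "p = (v, xs)" by fastforce
    have "path_act (Poly_Mapping.single p 1) m \<in> N"
    proof (cases "xs = []")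
      case True
      then show ?thesis
        using e[of v m] m that p by (simp add: e_def qpaths_def)
    next
      case False
      moreover have "set xs \<subseteq> arcs Q"
        using that p by (simp add: qpaths_def)
      ultimately show ?thesis
        using words[OF m] path_act_word[of v xs m] that p by simp
    qed
    then show ?thesis
      using sub subspace_scale scale_path_act[OF that, of c m] by metis
  qed
  then have "path_act f m \<in> N"
    unfolding path_act_expand[OF f(1)] using sub f(1) by (intro subspace_sum) auto
  then show "act a m \<in> N"
    using f(2) by (simp add: path_act_def)
qed

lemma pointwise_artinianD:
  assumes "pointwise_artinian Q \<rho> act" "u \<in> verts Q" "decseq N"
    and "\<And>i. subspace (N i)"
    and "\<And>i v m. v \<in> verts Q \<Longrightarrow> m \<in> N i \<Longrightarrow> e v m \<in> N i"
    and "\<And>i x m. x \<in> arcs Q \<Longrightarrow> m \<in> N i \<Longrightarrow> arr x m \<in> N i"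
  obtains n where "\<And>i. i \<ge> n \<Longrightarrow> e u ` N i = e u ` N n"
proof -
  have "\<forall>i. submodule (quiver_algebra Q \<rho>) act (N i)"
    using assms(4-6) submoduleI by blast
  with assms(3) have "(\<forall>i. submodule (quiver_algebra Q \<rho>) act (N i)) \<and> decseq N"
    by (rule conjI[rotated])
  from assms(1)[unfolded pointwise_artinian_def, rule_format, OF this assms(2)]
  have "\<exists>n. \<forall>i\<ge>n. e u ` N i = e u ` N n"
    unfolding vertex_part_eq .
  then show thesis
    using that by blast
qed

text \<open>Generators are replaced by their components \<open>e v s\<close>, so that each sits at
  one vertex. Words of arrows applied to these span a submodule, which therefore contains the one
  generated by \<open>S\<close>; applying \<open>e u\<close> gives the claim.\<close>

lemma finitely_controlledD:
  assumes "finitely_controlled Q \<rho> act" "u \<in> verts Q"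
  obtains G where "finite G" "\<And>g. g \<in> G \<Longrightarrow> \<exists>t\<in>verts Q. e t g = g"
    and "\<And>m. e u m \<in> span {e u (foldr arr xs g) |xs g. set xs \<subseteq> arcs Q \<and> g \<in> G}"
proof -
  obtain S where S: "finite S" "\<And>m. e u m \<in> submodule (quiver_algebra Q \<rho>) act hull S"
  proof -
    from assms obtain N where "fin_gen_submodule (quiver_algebra Q \<rho>) act N" "e u ` UNIV \<subseteq> N"
      unfolding finitely_controlled_def vertex_part_eq by meson
    then show thesis
      using that unfolding fin_gen_submodule_def by (metis rangeI subset_iff)
  qed
  define G where "G = (\<Union>s\<in>S. (\<lambda>v. e v s) ` supp s)"
  define W where "W = {foldr arr xs g |xs g. set xs \<subseteq> arcs Q \<and> g \<in> G}"
  have G: "finite G" "\<And>g. g \<in> G \<Longrightarrow> \<exists>t\<in>verts Q. e t g = g"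
  proof -
    show "finite G"
      using S(1) supp_decomposition(1) by (simp add: G_def)
    fix g assume "g \<in> G"
    then obtain s v where "v \<in> supp s" "g = e v s"
      unfolding G_def by blast
    then show "\<exists>t\<in>verts Q. e t g = g"
      using e_e[of v v s] by (auto simp: supp_def)
  qed
  have GW: "G \<subseteq> W"
    unfolding W_def by (auto intro!: exI[of _ "[]"])
  have eW: "e v w \<in> span W" if "v \<in> verts Q" "w \<in> W" for v w
  proof -
    from \<open>w \<in> W\<close> obtain xs g where w: "w = foldr arr xs g" "set xs \<subseteq> arcs Q" "g \<in> G"
      unfolding W_def by blast
    show ?thesis
    proof (cases xs)
      case Nil
      obtain t where t: "t \<in> verts Q" "e t g = g"
        using G(2) w by blast
      then have "e v w = (if v = t then w else 0)"
        using e_e[OF that(1) t(1), of g] w Nil by auto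
      then show ?thesis
        using that by (auto intro: span_base span_zero)
    next
      case (Cons x ys)
      then have "e v w = (if v = head Q x then w else 0)"
        using w that by (simp add: e_arr)
      then show ?thesis
        using that by (auto intro: span_base span_zero)
    qed
  qed
  have arrW: "arr x w \<in> span W" if "x \<in> arcs Q" "w \<in> W" for x w
  proof -
    from \<open>w \<in> W\<close> obtain xs g where w: "w = foldr arr xs g" "set xs \<subseteq> arcs Q" "g \<in> G"
      unfolding W_def by blast
    then have "arr x w \<in> W"
      unfolding W_def using that by (auto intro!: exI[of _ "x # xs"])
    then show ?thesis by (rule span_base)
  qed
  have image: "f m \<in> span W"
    if f: "Vector_Spaces.linear scale scale f" and "m \<in> span W" "\<And>w. w \<in> W \<Longrightarrow> f w \<in> span W" for f m
  proof -
    interpret f: Vector_Spaces.linear scale scale f by fact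
    have "f m \<in> span (f ` W)"
      using that by (simp add: f.span_image)
    also have "\<dots> \<subseteq> span W"
      using that by (intro span_minimal subspace_span) auto
    finally show ?thesis .
  qed
  have "submodule (quiver_algebra Q \<rho>) act (span W)"
    by (rule submoduleI[OF subspace_span image[OF linear_e _ eW] image[OF linear_arr _ arrW]])
  moreover have "S \<subseteq> span W"
  proof
    fix s assume "s \<in> S"
    then have "(\<Sum>v\<in>supp s. e v s) \<in> span W"
      using GW unfolding G_def by (intro span_sum span_base) auto
    then show "s \<in> span W"
      using supp_decomposition(2)[of s] by simp
  qed
  ultimately have hull: "submodule (quiver_algebra Q \<rho>) act hull S \<subseteq> span W"
    by (rule hull_minimal[rotated])
  show thesis
  proof (rule that[OF G])
    fix m
    interpret f: Vector_Spaces.linear scale scale "e u"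
      by (rule linear_e[OF assms(2)])
    have "e u (e u m) \<in> e u ` span W"
      using S(2) hull by blast
    also have "\<dots> = span (e u ` W)"
      by (simp add: f.span_image)
    also have "e u ` W = {e u (foldr arr xs g) |xs g. set xs \<subseteq> arcs Q \<and> g \<in> G}"
      unfolding W_def by auto
    finally show "e u m \<in> span {e u (foldr arr xs g) |xs g. set xs \<subseteq> arcs Q \<and> g \<in> G}"
      using e_e[OF assms(2) assms(2), of m] by simp
  qed
qed

section \<open>Words of arrows\<close>

lemma goodD:
  assumes "good x y"
  shows "x \<in> arcs Q" "y \<in> arcs Q" "tail Q x = head Q y"
  using assms by (auto simp: good_def qpaths_def)

lemma good_left_unique: "good x y \<Longrightarrow> good x' y \<Longrightarrow> x = x'"
  using at_most_one_left[of y] goodD(2)[of x y] by (auto simp: good_def dest: Uniq_D)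

lemma good_right_unique: "good x y \<Longrightarrow> good x y' \<Longrightarrow> y = y'"
  using at_most_one_right[of x] goodD(1)[of x y] by (auto simp: good_def dest: Uniq_D)

lemma linear_word: "set xs \<subseteq> arcs Q \<Longrightarrow> Vector_Spaces.linear scale scale (foldr arr xs)"
proof (induction xs)
  case Nil
  show ?case by unfold_locales (simp_all add: scale_right_distrib)
next
  case (Cons x xs)
  then interpret f: Vector_Spaces.linear scale scale "foldr arr xs" by simp
  interpret g: Vector_Spaces.linear scale scale "arr x"
    using Cons.prems by (intro linear_arr) simp
  show ?case
    by unfold_locales (simp_all add: f.add f.scale g.add g.scale scale_right_distrib)
qed

lemma word_zero: "set xs \<subseteq> arcs Q \<Longrightarrow> foldr arr xs 0 = 0"
  by (induction xs) (simp_all add: arr_zero)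

lemma word_bad: "set xs \<subseteq> arcs Q \<Longrightarrow> \<not> successively good xs \<Longrightarrow> foldr arr xs m = 0"
proof (induction xs)
  case (Cons x xs)
  show ?case
  proof (cases "successively good xs")
    case True
    then obtain y ys where "xs = y # ys" "\<not> good x y"
      using Cons.prems by (cases xs) auto
    then show ?thesis
      using Cons.prems arr_arr_bad[of x y] by simp
  next
    case False
    then show ?thesis
      using Cons by (simp add: arr_zero)
  qed
qed simp

lemma e_word:
  assumes "v \<in> verts Q" "set xs \<subseteq> arcs Q" "xs \<noteq> []"
  shows "e v (foldr arr xs m) = (if v = head Q (hd xs) then foldr arr xs m else 0)"
  using assms by (cases xs) (auto simp: e_arr)

lemma word_e:
  assumes "v \<in> verts Q" "set xs \<subseteq> arcs Q" "xs \<noteq> []"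
  shows "foldr arr xs (e v m) = (if v = tail Q (last xs) then foldr arr xs m else 0)"
proof -
  have xs: "xs = butlast xs @ [last xs]"
    using assms by simp
  have "set (butlast xs) \<subseteq> arcs Q" "last xs \<in> arcs Q"
    using assms by (auto dest: in_set_butlastD)
  then show ?thesis
    using assms(1) by (subst (1 3) xs) (simp add: arr_e word_zero del: append_butlast_last_id)
qed

text \<open>By \<open>good_left_unique\<close> each arrow determines the one to its left, so two
  words with the same last arrow agree from the right until one of them ends.\<close>

lemma good_suffix_compare:
  assumes "successively good p" "successively good q" "p \<noteq> []" "q \<noteq> []" "last p = last q"
  shows "(\<exists>d. q = d @ p) \<or> (\<exists>d. p = d @ q)"
  using assms
proof (induction p)
  case (Cons x p)
  show ?case
  proof (cases "p = []")
    case True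
    then show ?thesis
      using Cons.prems append_butlast_last_id[of q] by (metis last.simps)
  next
    case False
    then have "(\<exists>d. q = d @ p) \<or> (\<exists>d. p = d @ q)"
      using Cons.prems by (intro Cons.IH) (auto simp: successively_Cons)
    then show ?thesis
    proof
      assume "\<exists>d. p = d @ q"
      then show ?thesis by (metis append_Cons)
    next
      assume "\<exists>d. q = d @ p"
      then obtain d where d: "q = d @ p" by blast
      show ?thesis
      proof (cases d rule: rev_cases)
        case Nil
        then show ?thesis using d by (metis append_Cons append_Nil)
      next
        case (snoc d' z)
        then have "good z (hd p)"
          using d False Cons.prems(2) by (auto simp: successively_append_iff successively_Cons)
        moreover have "good x (hd p)"
          using False Cons.prems(1) by (auto simp: successively_Cons)
        ultimately show ?thesis
          using d snoc good_left_unique by auto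
      qed
    qed
  qed
qed simp

text \<open>A good word into \<open>u\<close> whose leftmost arrow recurs begins with a primitive
  cycle; these are the words that remain when such cycles are stripped off.\<close>

definition first_words :: "'v \<Rightarrow> 'v \<Rightarrow> 'a list set" where
  "first_words u t = {p. p \<noteq> [] \<and> set p \<subseteq> arcs Q \<and> successively good p \<and> hd p \<notin> set (tl p) \<and>
     head Q (hd p) = u \<and> tail Q (last p) = t}"

text \<open>Goodness of \<open>r @ [hd r]\<close> lets the cycle be repeated. A primitive cycle may
  pass through \<open>u\<close> again, but only by an arrow other than \<open>hd r\<close>.\<close>

definition prim_cycles :: "'v \<Rightarrow> 'a list set" where
  "prim_cycles u = {r. r \<noteq> [] \<and> set r \<subseteq> arcs Q \<and> successively good (r @ [hd r]) \<and> hd r \<notin> set (tl r) \<and>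
     head Q (hd r) = u}"

lemma no_proper_suffix:
  assumes "q = d @ p" "p \<noteq> []" "hd p = hd q" "hd q \<notin> set (tl q)"
  shows "q = p"
proof (cases d)
  case (Cons z zs)
  then have "hd p \<in> set (tl q)"
    using assms(1,2) by simp
  with assms(3,4) show ?thesis by simp
qed (use assms in simp)

text \<open>By \<open>good_suffix_compare\<close> one word is a suffix of the other, and a proper
  suffix would make the first arrow recur.\<close>

lemma first_words_eqI:
  assumes "p \<in> first_words u t" "q \<in> first_words u t'" "hd p = hd q" "last p = last q"
  shows "p = q"
proof -
  have "(\<exists>d. q = d @ p) \<or> (\<exists>d. p = d @ q)"
    using assms by (intro good_suffix_compare) (auto simp: first_words_def)
  then show ?thesis
  proof (elim disjE exE)
    fix d assume "q = d @ p"
    then have "q = p"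
      by (rule no_proper_suffix) (use assms in \<open>auto simp: first_words_def\<close>)
    then show ?thesis ..
  next
    fix d assume "p = d @ q"
    then show ?thesis
      by (rule no_proper_suffix) (use assms in \<open>auto simp: first_words_def\<close>)
  qed
qed

text \<open>Appending the common first arrow gives two words with the same last arrow, to which
  \<open>good_suffix_compare\<close> applies.\<close>

lemma prim_cycles_eqI:
  assumes "p \<in> prim_cycles u" "q \<in> prim_cycles u" "hd p = hd q"
  shows "p = q"
proof -
  have "(\<exists>d. q @ [hd q] = d @ p @ [hd p]) \<or> (\<exists>d. p @ [hd p] = d @ q @ [hd q])"
    using assms by (intro good_suffix_compare) (auto simp: prim_cycles_def)
  then have "(\<exists>d. q = d @ p) \<or> (\<exists>d. p = d @ q)"
    using assms(3) by auto
  then show ?thesis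
  proof (elim disjE exE)
    fix d assume "q = d @ p"
    then have "q = p"
      by (rule no_proper_suffix) (use assms in \<open>auto simp: prim_cycles_def\<close>)
    then show ?thesis ..
  next
    fix d assume "p = d @ q"
    then show ?thesis
      by (rule no_proper_suffix) (use assms in \<open>auto simp: prim_cycles_def\<close>)
  qed
qed

lemma finite_first_words:
  assumes "u \<in> verts Q" "t \<in> verts Q"
  shows "finite (first_words u t)"
proof -
  let ?f = "\<lambda>p. (hd p, last p)"
  have "inj_on ?f (first_words u t)"
    by (auto intro!: inj_onI intro: first_words_eqI)
  moreover have "?f ` first_words u t \<subseteq> {x \<in> arcs Q. head Q x = u} \<times> {x \<in> arcs Q. tail Q x = t}"
    by (auto simp: first_words_def)
  then have "finite (?f ` first_words u t)"
    using at_most_two_in[OF assms(1)] at_most_two_out[OF assms(2)] by (blast intro: finite_subset)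
  ultimately show ?thesis
    by (rule finite_imageD[rotated])
qed

lemma finite_prim_cycles:
  assumes "u \<in> verts Q"
  shows "finite (prim_cycles u)"
proof -
  have "inj_on hd (prim_cycles u)"
    by (auto intro!: inj_onI intro: prim_cycles_eqI)
  moreover have "hd ` prim_cycles u \<subseteq> {x \<in> arcs Q. head Q x = u}"
    by (auto simp: prim_cycles_def)
  then have "finite (hd ` prim_cycles u)"
    using at_most_two_in[OF assms(1)] by (blast intro: finite_subset)
  ultimately show ?thesis
    by (rule finite_imageD[rotated])
qed

section \<open>Socles\<close>

text \<open>The part of the socle on which all arrows vanish. A simple submodule on which a cycle
  acts nontrivially is not seen here.\<close>

definition socle :: "'v \<Rightarrow> 'm set" where
  "socle u = {m \<in> range (e u). \<forall>x\<in>arcs Q. tail Q x = u \<longrightarrow> arr x m = 0}"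

lemma range_e: "u \<in> verts Q \<Longrightarrow> m \<in> range (e u) \<longleftrightarrow> e u m = m"
  using e_e[of u u] by (metis rangeE rangeI)

text \<open>On the socle at \<open>u\<close> arrows act as zero and each \<open>e v\<close> as one
  or zero, so a chain of subspaces is a chain of submodules. As \<open>e u\<close> fixes their
  elements, the chain itself stabilizes.\<close>

lemma dcc_socle_artinian:
  assumes "pointwise_artinian Q \<rho> act" "u \<in> verts Q"
  shows "dcc (socle u)"
  unfolding dcc_def
proof (intro allI impI, elim conjE)
  fix N :: "nat \<Rightarrow> 'm set"
  assume N: "decseq N" "\<forall>i. subspace (N i)" "N 0 \<subseteq> socle u"
  have soc: "m \<in> socle u" if "m \<in> N i" for m i
    using decseqD[OF N(1), of 0 i] N(3) that by blast
  have eu: "e u m = m" if "m \<in> N i" for m i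
    using soc[OF that] assms(2) by (simp add: socle_def range_e)
  have "e v m \<in> N i" if "v \<in> verts Q" "m \<in> N i" for v m i
    using e_e[OF that(1) assms(2), of m] eu[OF that(2)] that N(2) subspace_0
    by (metis (full_types))
  moreover have "arr x m \<in> N i" if "x \<in> arcs Q" "m \<in> N i" for x m i
  proof -
    have "arr x m = 0"
      using soc[OF that(2)] arr_e[OF assms(2) that(1), of m] eu[OF that(2)] that(1)
      by (auto simp: socle_def split: if_splits)
    then show ?thesis
      using N(2) subspace_0 by simp
  qed
  ultimately obtain n where n: "\<And>i. i \<ge> n \<Longrightarrow> e u ` N i = e u ` N n"
    using pointwise_artinianD[OF assms N(1)] N(2) by blast
  have "e u ` N i = N i" for i
    using eu by force
  then show "\<exists>n. \<forall>i\<ge>n. N i = N n"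
    using n by auto
qed

text \<open>
  The sum \<open>T\<close> of the primitive cycles at \<open>u\<close> kills the socle, and \<open>e\<^sub>u M\<close> is finitely generated
  over \<open>k[T]\<close>: a word ending in an arrow \<open>a\<close> into \<open>u\<close> that occurs more than once is a primitive
  cycle times a shorter word ending in \<open>a\<close>, and the other primitive cycle kills that shorter word.
\<close>

lemma dcc_socle_finitely_controlled:
  assumes fc: "finitely_controlled Q \<rho> act" and u: "u \<in> verts Q"
  shows "dcc (socle u)"
proof -
  obtain G where G: "finite G" "\<And>g. g \<in> G \<Longrightarrow> \<exists>t\<in>verts Q. e t g = g"
    and gen: "\<And>m. e u m \<in> span {e u (foldr arr xs g) |xs g. set xs \<subseteq> arcs Q \<and> g \<in> G}"
    using finitely_controlledD[OF fc u] by blast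
  define T where "T = (\<lambda>m. \<Sum>r\<in>prim_cycles u. foldr arr r m)"
  \<comment> \<open>A finite generating set over \<open>k[T]\<close>: the first part of the union
    covers the empty word, the second the words whose leftmost arrow does not recur.\<close>
  define B where "B = e u ` G \<union> (\<Union>g\<in>G. \<Union>t\<in>supp g. (\<lambda>p. foldr arr p g) ` first_words u t)"
  let ?H = "span (\<Union>i. (T ^^ i) ` B)"
  have B: "finite B"
    using G(1) supp_decomposition(1) finite_first_words[OF u]
    by (auto simp: B_def supp_def)
  have lin: "Vector_Spaces.linear scale scale (foldr arr r)" if "r \<in> prim_cycles u" for r
    using that by (intro linear_word) (simp add: prim_cycles_def)
  have T: "Vector_Spaces.linear scale scale T"
  proof -
    have "foldr arr r (m + n) = foldr arr r m + foldr arr r n"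
      "foldr arr r (scale c m) = scale c (foldr arr r m)" if "r \<in> prim_cycles u" for r m n c
    proof -
      interpret f: Vector_Spaces.linear scale scale "foldr arr r" by (rule lin[OF that])
      show "foldr arr r (m + n) = foldr arr r m + foldr arr r n"
        "foldr arr r (scale c m) = scale c (foldr arr r m)"
        by (simp_all add: f.add f.scale)
    qed
    then show ?thesis
      by unfold_locales (simp_all add: T_def scale_right_distrib sum.distrib scale_sum_right)
  qed
  interpret T: Vector_Spaces.linear scale scale T by (rule T)
  have TH: "T z \<in> ?H" if "z \<in> ?H" for z
  proof -
    have "T z \<in> span (T ` (\<Union>i. (T ^^ i) ` B))"
      using that by (simp add: T.span_image)
    also have "\<dots> \<subseteq> ?H"
    proof (rule span_mono)
      have "T ((T ^^ i) b) = (T ^^ Suc i) b" for i b by simp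
      then show "T ` (\<Union>i. (T ^^ i) ` B) \<subseteq> (\<Union>i. (T ^^ i) ` B)" by blast
    qed
    finally show ?thesis .
  qed
  have BH: "b \<in> ?H" if "b \<in> B" for b
    using that by (intro span_base UN_I[of 0]) auto
  have words: "e u (foldr arr xs g) \<in> ?H" if "set xs \<subseteq> arcs Q" "g \<in> G" for xs g
    using that(1)
  proof (induction "length xs" arbitrary: xs rule: less_induct)
    case less
    consider "xs = []" | "e u (foldr arr xs g) = 0"
      | "xs \<noteq> []" "foldr arr xs g \<noteq> 0" "head Q (hd xs) = u" "successively good xs"
      using e_word[OF u less.prems, of g] e_zero[OF u] word_bad[OF less.prems, of g]
      by (cases "xs = []") (auto split: if_splits)
    then show ?case
    proof cases
      case 1
      then show ?thesis
        using \<open>g \<in> G\<close> by (intro BH) (auto simp: B_def)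
    next
      case 2
      then show ?thesis by (simp add: span_zero)
    next
      case 3
      define a where "a = hd xs"
      have eu: "e u (foldr arr xs g) = foldr arr xs g"
        using 3 e_word[OF u less.prems, of g] by simp
      show ?thesis
      proof (cases "a \<in> set (tl xs)")
        case False
        obtain t where t: "t \<in> verts Q" "e t g = g"
          using G(2) \<open>g \<in> G\<close> by blast
        have "tail Q (last xs) = t"
          using word_e[OF t(1) less.prems 3(1), of g] t(2) 3(2) by (auto split: if_splits)
        then have "xs \<in> first_words u t"
          using 3 False less.prems by (simp add: first_words_def a_def)
        moreover have "g \<noteq> 0"
          using 3(2) word_zero[OF less.prems] by auto
        then have "t \<in> supp g"
          using t by (simp add: supp_def)
        ultimately have "foldr arr xs g \<in> B"
          using \<open>g \<in> G\<close> unfolding B_def by blast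
        then show ?thesis
          using eu BH by simp
      next
        case True
        \<comment> \<open>Splitting at the next occurrence of \<open>a\<close> keeps
          \<open>a\<close> out of \<open>q1\<close>, so \<open>r\<close> is a primitive cycle, and
          the remaining word \<open>a # q2\<close> is shorter.\<close>
        then obtain q1 q2 where q: "tl xs = q1 @ a # q2" "a \<notin> set q1"
          by (meson split_list_first)
        define r where "r = a # q1"
        have xs: "xs = r @ a # q2"
          using q 3(1) by (metis a_def append_Cons list.collapse r_def)
        have "successively good ((r @ [a]) @ q2)"
          using 3(4) xs by simp
        then have "successively good (r @ [a])"
          by (simp only: successively_append_iff)
        then have r: "r \<in> prim_cycles u"
          using 3(3) less.prems xs q by (auto simp: prim_cycles_def r_def)
        define z where "z = foldr arr (a # q2) g"
        have a: "a \<in> arcs Q" "head Q a = u" "set (a # q2) \<subseteq> arcs Q"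
          using 3(3) less.prems xs by (auto simp: r_def)
        have "z \<in> ?H"
          using less.hyps[of "a # q2"] a xs e_word[OF u a(3), of g]
          by (simp add: z_def r_def)
        moreover have "T z = foldr arr r z"
        proof -
          \<comment> \<open>A primitive cycle other than \<open>r\<close> begins with an arrow
            different from \<open>a\<close>. Its last arrow has a nonzero product only with its own
            first arrow, so it kills every word beginning with \<open>a\<close>.\<close>
          have "foldr arr s z = 0" if s: "s \<in> prim_cycles u - {r}" for s
          proof -
            have "hd s \<noteq> a"
              using s r prim_cycles_eqI[of s u r] by (auto simp: r_def)
            have "s \<noteq> []" "good (last s) (hd s)"
              using s by (auto simp: prim_cycles_def successively_append_iff)
            with \<open>hd s \<noteq> a\<close> have "\<not> good (last s) a"
              using good_right_unique by blast
            then have "\<not> successively good (s @ a # q2)"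
              using \<open>s \<noteq> []\<close> by (simp add: successively_append_iff)
            moreover have "set (s @ a # q2) \<subseteq> arcs Q"
              using a s by (auto simp: prim_cycles_def)
            ultimately show ?thesis
              using word_bad[of "s @ a # q2" g] by (simp add: z_def)
          qed
          then show ?thesis
            unfolding T_def using sum.remove[OF finite_prim_cycles[OF u] r, of "\<lambda>s. foldr arr s z"] by simp
        qed
        ultimately have "foldr arr r z \<in> ?H"
          using TH by metis
        then show ?thesis
          using eu xs by (simp add: z_def)
      qed
    qed
  qed
  have "socle u \<subseteq> {x \<in> ?H. T x = 0}"
  proof
    fix m assume m: "m \<in> socle u"
    have "foldr arr r m = 0" if r: "r \<in> prim_cycles u" for r
    proof -
      have "r \<noteq> []" and good: "good (last r) (hd r)" and arcs: "set r \<subseteq> arcs Q" and hd: "head Q (hd r) = u"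
        using r by (auto simp: prim_cycles_def successively_append_iff)
      then have eq: "r = butlast r @ [last r]"
        by simp
      have "arr (last r) m = 0"
        using m goodD[OF good] hd by (simp add: socle_def)
      then have "foldr arr r m = foldr arr (butlast r) 0"
        by (subst eq) (simp del: append_butlast_last_id)
      also have "\<dots> = 0"
        using arcs by (intro word_zero) (auto dest: in_set_butlastD)
      finally show ?thesis .
    qed
    then have "T m = 0"
      by (simp add: T_def)
    moreover have "m \<in> ?H"
    proof -
      have "e u m = m"
        using m u by (simp add: socle_def range_e)
      moreover have "span {e u (foldr arr xs g) |xs g. set xs \<subseteq> arcs Q \<and> g \<in> G} \<subseteq> ?H"
        using words by (intro span_minimal subspace_span) auto
      then have "e u m \<in> ?H"
        using gen[of m] by (rule subsetD)
      ultimately show ?thesis by simp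
    qed
    ultimately show "m \<in> {x \<in> ?H. T x = 0}" by simp
  qed
  then show ?thesis
    by (rule dcc_mono[OF dcc_kernel_fin_gen[OF T B]])
qed

text \<open>Nonempty lists that are not paths starting at \<open>u\<close> act as zero on the part
  at \<open>u\<close>, so the condition is one on paths. For \<open>j = 0\<close> the empty list
  leaves only the zero element.\<close>

definition killed :: "nat \<Rightarrow> 'v \<Rightarrow> 'm set" where
  "killed j u = {m \<in> range (e u). \<forall>c. length c = j \<and> set c \<subseteq> arcs Q \<longrightarrow> foldr arr c m = 0}"

text \<open>An arrow \<open>x\<close> out of \<open>u\<close> maps \<open>killed (Suc j) u\<close>
  into \<open>killed j (head Q x)\<close>, and the common kernel of the finitely many arrows out of
  \<open>u\<close> lies in the socle; \<open>dcc_kernels\<close> combines the two.\<close>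

lemma dcc_killed:
  assumes socle: "\<And>u. u \<in> verts Q \<Longrightarrow> dcc (socle u)" and "u \<in> verts Q"
  shows "dcc (killed j u)"
  using assms(2)
proof (induction j arbitrary: u)
  case 0
  have "killed 0 u \<subseteq> {0}"
    by (auto simp: killed_def)
  moreover have "dcc {0}"
  proof (rule dcc_bounded)
    fix B assume "B \<subseteq> {0 :: 'm}" "independent B"
    then have "B = {}"
      using dependent_zero by blast
    then show "finite B \<and> card B \<le> 0" by simp
  qed
  ultimately show ?case
    using dcc_mono by blast
next
  case (Suc j)
  let ?A = "{x \<in> arcs Q. tail Q x = u}"
  show ?case
  proof (rule dcc_kernels[of ?A arr])
    show "finite ?A"
      using at_most_two_out[OF Suc.prems] by simp
    show "Vector_Spaces.linear scale scale (arr x)" if "x \<in> ?A" for x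
      using that by (intro linear_arr) simp
    show "dcc (arr x ` killed (Suc j) u)" if x: "x \<in> ?A" for x
    proof (rule dcc_mono)
      have h: "head Q x \<in> verts Q"
        using x by simp
      then show "dcc (killed j (head Q x))"
        by (rule Suc.IH)
      show "arr x ` killed (Suc j) u \<subseteq> killed j (head Q x)"
      proof
        fix m assume "m \<in> arr x ` killed (Suc j) u"
        then obtain m' where m': "m' \<in> killed (Suc j) u" "m = arr x m'" by blast
        have "foldr arr c m = 0" if "length c = j" "set c \<subseteq> arcs Q" for c
        proof -
          have "length (c @ [x]) = Suc j" "set (c @ [x]) \<subseteq> arcs Q"
            using that x by simp_all
          then have "foldr arr (c @ [x]) m' = 0"
            using m'(1) unfolding killed_def by blast
          then show ?thesis
            using m'(2) by simp
        qed
        moreover have "m \<in> range (e (head Q x))"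
          using m'(2) x h by (simp add: range_e e_arr)
        ultimately show "m \<in> killed j (head Q x)"
          by (simp add: killed_def)
      qed
    qed
    have "{m \<in> killed (Suc j) u. \<forall>x\<in>?A. arr x m = 0} \<subseteq> socle u"
      by (auto simp: killed_def socle_def)
    then show "dcc {m \<in> killed (Suc j) u. \<forall>x\<in>?A. arr x m = 0}"
      by (rule dcc_mono[OF socle[OF Suc.prems]])
  qed
qed

section \<open>Images under words\<close>

text \<open>Recursive form of the image of the initial word of length \<open>n\<close>: peeling off
  the first letter lets inductions pass to the shifted word.\<close>

primrec truncated_image :: "nat \<Rightarrow> (nat \<Rightarrow> 'a letter) \<Rightarrow> 'm set" where
  "truncated_image 0 C = range (e (letter_head Q (C 0)))"
| "truncated_image (Suc n) C = letter_rel Q \<rho> act (C 0) `` truncated_image n (\<lambda>i. C (Suc i))"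

section \<open>Elementary facts on words and their images\<close>

lemma N_wordD:
  assumes "N_word Q \<rho> C"
  shows "letter_arrow (C i) \<in> arcs Q" "letter_tail Q (C i) = letter_head Q (C (Suc i))"
    "letter_inv (C i) \<noteq> C (Suc i)"
  using assms by (auto simp: N_word_def)

lemma N_word_shift:
  assumes "N_word Q \<rho> C"
  shows "N_word Q \<rho> (\<lambda>i. C (n + i))"
proof -
  have shift: "map (\<lambda>i. C (n + i)) [i..<i + k] = map C [n + i..<(n + i) + k]" for i k
    by (rule nth_equalityI) (simp_all add: add.assoc)
  show ?thesis
    using assms unfolding N_word_def shift by (auto simp: split_beta)
qed

lemma N_word_Suc: "N_word Q \<rho> C \<Longrightarrow> N_word Q \<rho> (\<lambda>i. C (Suc i))"
  using N_word_shift[of C 1] by simp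

lemma N_word_direct_direct:
  assumes C: "N_word Q \<rho> C" and "C 0 = Direct x" "C 1 = Direct y"
  shows "good x y"
proof -
  have "x \<in> arcs Q" "y \<in> arcs Q" "tail Q x = head Q y"
    using N_wordD[OF C, of 0] N_wordD(1)[OF C, of 1] assms by (simp_all add: letter_tail_def)
  moreover have "(head Q x, [x, y]) \<notin> \<rho>"
  proof
    assume "(head Q x, [x, y]) \<in> \<rho>"
    then have "map C [0..<0 + length [x, y]] \<noteq> map Direct [x, y]"
      using C unfolding N_word_def by fast
    then show False
      using assms by (simp add: upt_rec)
  qed
  ultimately show ?thesis
    by (simp add: good_def qpaths_def)
qed

lemma N_word_inverse_inverse:
  assumes C: "N_word Q \<rho> C" and "C 0 = Inverse y" "C 1 = Inverse z"
  shows "good z y"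
proof -
  have "z \<in> arcs Q" "y \<in> arcs Q" "tail Q z = head Q y"
    using N_wordD[OF C, of 0] N_wordD(1)[OF C, of 1] assms by (simp_all add: letter_tail_def)
  moreover have "(head Q z, [z, y]) \<notin> \<rho>"
  proof
    assume "(head Q z, [z, y]) \<in> \<rho>"
    then have "map C [0..<0 + length [z, y]] \<noteq> map Inverse (rev [z, y])"
      using C unfolding N_word_def by fast
    then show False
      using assms by (simp add: upt_rec)
  qed
  ultimately show ?thesis
    by (simp add: good_def qpaths_def)
qed

lemma letter_verts:
  assumes "letter_arrow l \<in> arcs Q"
  shows "letter_head Q l \<in> verts Q" "letter_tail Q l \<in> verts Q"
  using assms by (cases l; simp add: letter_tail_def)+

lemma letter_rel_Image:
  "letter_rel Q \<rho> act (Direct x) `` S = arr x ` (S \<inter> range (e (tail Q x)))"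
  "letter_rel Q \<rho> act (Inverse x) `` S = {m \<in> range (e (tail Q x)). arr x m \<in> S}"
  unfolding letter_rel_eq by blast+

lemma letter_rel_Image_subset:
  assumes "letter_arrow l \<in> arcs Q"
  shows "letter_rel Q \<rho> act l `` S \<subseteq> range (e (letter_head Q l))"
proof (cases l)
  case (Direct x)
  then have "x \<in> arcs Q" "head Q x \<in> verts Q"
    using assms by simp_all
  then show ?thesis
    unfolding Direct letter_rel_Image by (auto simp: range_e e_arr)
next
  case (Inverse x)
  then show ?thesis
    unfolding Inverse letter_rel_Image by simp
qed

lemma subspace_letter_rel_Image:
  assumes "letter_arrow l \<in> arcs Q" "subspace S"
  shows "subspace (letter_rel Q \<rho> act l `` S)"
proof -
  define x where "x = letter_arrow l"
  have x: "x \<in> arcs Q" "tail Q x \<in> verts Q"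
    using assms by (simp_all add: x_def)
  interpret f: Vector_Spaces.linear scale scale "arr x"
    using x by (intro linear_arr)
  interpret g: Vector_Spaces.linear scale scale "e (tail Q x)"
    using x by (intro linear_e)
  have sub: "subspace (range (e (tail Q x)))"
    by (rule g.subspace_image[OF subspace_UNIV])
  show ?thesis
  proof (cases l)
    case (Direct y)
    then show ?thesis
      using f.subspace_image[OF subspace_inter[OF assms(2) sub]]
      by (simp add: letter_rel_Image x_def del: letter_rel.simps)
  next
    case (Inverse y)
    then have "letter_rel Q \<rho> act l `` S = range (e (tail Q x)) \<inter> arr x -` S"
      by (auto simp: letter_rel_Image x_def simp del: letter_rel.simps)
    then show ?thesis
      using subspace_inter[OF sub f.subspace_vimage[OF assms(2)]] by simp
  qed
qed

lemma subspace_truncated_image: "N_word Q \<rho> C \<Longrightarrow> subspace (truncated_image n C)"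
proof (induction n arbitrary: C)
  case 0
  interpret f: Vector_Spaces.linear scale scale "e (letter_head Q (C 0))"
    using N_wordD(1)[OF 0] by (intro linear_e letter_verts)
  show ?case
    by (simp add: f.subspace_image[OF subspace_UNIV])
next
  case (Suc n)
  then show ?case
    using Suc.IH[OF N_word_Suc] subspace_letter_rel_Image N_wordD(1) by simp
qed

lemma truncated_image_subset: "N_word Q \<rho> C \<Longrightarrow> truncated_image n C \<subseteq> range (e (letter_head Q (C 0)))"
  using letter_rel_Image_subset N_wordD(1) by (cases n) simp_all

lemma decseq_truncated_image:
  assumes "N_word Q \<rho> C"
  shows "decseq (\<lambda>n. truncated_image n C)"
proof (rule decseq_SucI)
  fix n
  show "truncated_image (Suc n) C \<subseteq> truncated_image n C"
    using assms
  proof (induction n arbitrary: C)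
    case 0
    then show ?case using truncated_image_subset[OF 0, of "Suc 0"] by simp
  next
    case (Suc n)
    then show ?case using Suc.IH[OF N_word_Suc[OF Suc.prems]] by (simp add: Image_mono)
  qed
qed

lemma word_image_eq_truncated_image: "N_word Q \<rho> C \<Longrightarrow> word_image Q \<rho> act (initial_word Q C n) = truncated_image n C"
proof (induction n arbitrary: C)
  case 0
  show ?case
    by (auto simp: initial_word_def word_image_def vertex_part_eq)
next
  case (Suc n)
  have init: "initial_word Q C (Suc n) = (letter_head Q (C 0), C 0 # map (\<lambda>i. C (Suc i)) [0..<n])"
    by (simp add: initial_word_def map_upt_Suc del: upt_Suc)
  have "word_tail Q (initial_word Q C (Suc n)) = word_tail Q (initial_word Q (\<lambda>i. C (Suc i)) n)"
    unfolding init using N_wordD(2)[OF Suc.prems, of 0] by (auto simp: initial_word_def)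
  moreover have "word_rel Q \<rho> act (initial_word Q C (Suc n)) =
      word_rel Q \<rho> act (initial_word Q (\<lambda>i. C (Suc i)) n) O letter_rel Q \<rho> act (C 0)"
    unfolding init using N_wordD(2)[OF Suc.prems, of 0] by (simp add: initial_word_def)
  ultimately have "word_image Q \<rho> act (initial_word Q C (Suc n)) =
      letter_rel Q \<rho> act (C 0) `` word_image Q \<rho> act (initial_word Q (\<lambda>i. C (Suc i)) n)"
    by (simp add: word_image_def relcomp_Image)
  then show ?case
    using Suc.IH[OF N_word_Suc[OF Suc.prems]] by simp
qed

text \<open>
  If \<open>C = l y\<^sub>1\<^sup>-\<^sup>1 \<dots> y\<^sub>k\<^sup>-\<^sup>1 w \<dots>\<close> with \<open>w\<close> direct, then a nonzero word of length \<open>k + 1\<close> that can act on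
  \<open>m\<close> and is not excluded by \<open>l\<close> has the form \<open>t y\<^sub>k \<dots> y\<^sub>1\<close>; but \<open>y\<^sub>k \<dots> y\<^sub>1 m\<close> lies in the image of \<open>w\<close>,
  and \<open>t w = 0\<close> because \<open>t y\<^sub>k \<noteq> 0\<close> and \<open>w \<noteq> y\<^sub>k\<close>.
\<close>

lemma word_kills_truncated_image:
  assumes "N_word Q \<rho> C"
    and "\<forall>i<k. \<exists>y. C (Suc i) = Inverse y" and "C (Suc k) = Direct w"
    and "m \<in> truncated_image (Suc k) (\<lambda>i. C (Suc i))"
    and "length c = Suc k" "set c \<subseteq> arcs Q"
    and "case C 0 of Direct x \<Rightarrow> last c \<noteq> x | Inverse y \<Rightarrow> good (last c) y"
  shows "foldr arr c m = 0"
  using assms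
proof (induction k arbitrary: C m c)
  case 0
  then obtain t where c: "c = [t]"
    by (auto simp: length_Suc_conv)
  obtain m' where m: "m = arr w m'"
    using 0(3,4) by (auto simp: letter_rel_Image simp del: letter_rel.simps)
  have "w \<in> arcs Q" "t \<in> arcs Q"
    using N_wordD(1)[OF 0(1), of "Suc 0"] 0(3,6) c by simp_all
  \<comment> \<open>If \<open>good t w\<close> held, uniqueness would give \<open>t = x\<close> when
    the preceding letter is direct, against the hypothesis on \<open>last c\<close>, or
    \<open>y = w\<close> when it is inverse, against reducedness of the word.\<close>
  moreover have "\<not> good t w"
  proof
    assume t: "good t w"
    show False
    proof (cases "C 0")
      case (Direct x)
      then have "good x w"
        using N_word_direct_direct[OF 0(1), of x w] 0(3) by simp
      then show False
        using t good_left_unique 0(7) Direct c by auto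
    next
      case (Inverse y)
      then have "y = w"
        using t good_right_unique 0(7) c by auto
      then show False
        using N_wordD(3)[OF 0(1), of 0] Inverse 0(3) by simp
    qed
  qed
  ultimately show ?case
    using c m arr_arr_bad by simp
next
  case (Suc k)
  note C = Suc.prems(1)
  obtain y1 where y1: "C (Suc 0) = Inverse y1"
    using Suc.prems(2) by auto
  have arcs1: "y1 \<in> arcs Q" and tail1: "tail Q y1 \<in> verts Q"
    using N_wordD(1)[OF C, of "Suc 0"] y1 by simp_all
  have "m \<in> letter_rel Q \<rho> act (Inverse y1) `` truncated_image (Suc k) (\<lambda>i. C (Suc (Suc i)))"
    using Suc.prems(4) y1 by (simp del: letter_rel.simps)
  then have m: "m \<in> range (e (tail Q y1))" "arr y1 m \<in> truncated_image (Suc k) (\<lambda>i. C (Suc (Suc i)))"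
    unfolding letter_rel_Image by blast+
  obtain c' s where c: "c = c' @ [s]" "length c' = Suc k"
    using Suc.prems(5) by (cases c rule: rev_cases) auto
  then have arcs: "set c' \<subseteq> arcs Q" "s \<in> arcs Q"
    using Suc.prems(6) by auto
  show ?case
  proof (cases "arr s m = 0")
    case True
    then show ?thesis
      using c arcs by (simp add: word_zero)
  next
    case False
    have ts: "tail Q s = tail Q y1"
      using False m(1) tail1 arr_e[OF tail1 arcs(2), of m] by (auto simp: range_e split: if_splits)
    \<comment> \<open>For an inverse letter this is uniqueness of the left factor. For a direct
      letter, \<open>x\<close>, \<open>y1\<close> and \<open>s\<close> start at the same vertex,
      which is the tail of at most two arrows, and \<open>x\<close> differs from the other
      two.\<close>
    have s: "s = y1"
    proof (cases "C 0")
      case (Inverse y)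
      then have "good y1 y"
        using N_word_inverse_inverse[OF C, of y y1] y1 by simp
      moreover have "good s y"
        using Suc.prems(7) Inverse c by simp
      ultimately show ?thesis
        using good_left_unique by blast
    next
      case (Direct x)
      have "x \<noteq> y1" "tail Q x = tail Q y1" "x \<in> arcs Q" "s \<noteq> x"
        using N_wordD[OF C, of 0] Direct y1 Suc.prems(7) c by (auto simp: letter_tail_def)
      then have "{x, y1, s} \<subseteq> {a \<in> arcs Q. tail Q a = tail Q y1}"
        using arcs arcs1 ts by auto
      moreover have "finite {a \<in> arcs Q. tail Q a = tail Q y1}"
        "card {a \<in> arcs Q. tail Q a = tail Q y1} \<le> 2"
        using at_most_two_out[OF tail1] by simp_all
      ultimately have "card {x, y1, s} \<le> 2"
        using card_mono le_trans by meson
      then show ?thesis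
        using \<open>x \<noteq> y1\<close> \<open>s \<noteq> x\<close> by (auto simp: card_insert_if split: if_splits)
    qed
    \<comment> \<open>Either \<open>last c'\<close> satisfies the induction hypothesis for the
      shifted word, which begins with the inverse of \<open>y1\<close>, or its product with
      \<open>y1\<close> is zero.\<close>
    show ?thesis
    proof (cases "good (last c') y1")
      case True
      have "foldr arr c' (arr y1 m) = 0"
      proof (rule Suc.IH[of "\<lambda>i. C (Suc i)"])
        show "\<forall>i<k. \<exists>y. C (Suc (Suc i)) = Inverse y"
          using Suc.prems(2) by auto
      qed (use N_word_Suc[OF C] Suc.prems(3) m c arcs True y1 in auto)
      then show ?thesis
        using c s by simp
    next
      case False
      then have "\<not> successively good (c' @ [s])"
        using c s by (auto simp: successively_append_iff)
      then show ?thesis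
        using word_bad[of c] Suc.prems(6) c by blast
    qed
  qed
qed

text \<open>The inductive step for choosing the sequence in \<open>word_plus\<close>. The point is
  that one \<open>m1\<close> lies in all the images at once, so that the choice can
  continue.\<close>

lemma word_image_step:
  assumes dcc: "\<And>j u. u \<in> verts Q \<Longrightarrow> dcc (killed j u)"
    and C: "N_word Q \<rho> C" and m: "\<And>n. m \<in> truncated_image n C"
  obtains m1 where "(m1, m) \<in> letter_rel Q \<rho> act (C 0)" "\<And>n. m1 \<in> truncated_image n (\<lambda>i. C (Suc i))"
proof (cases "C 0")
  case (Inverse x)
  have "m \<in> letter_rel Q \<rho> act (Inverse x) `` truncated_image n (\<lambda>i. C (Suc i))" for n
    using m[of "Suc n"] Inverse by (simp del: letter_rel.simps)
  then have "m \<in> range (e (tail Q x))" and truncated_image: "\<And>n. arr x m \<in> truncated_image n (\<lambda>i. C (Suc i))"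
    unfolding letter_rel_Image by blast+
  then have "(arr x m, m) \<in> letter_rel Q \<rho> act (C 0)"
    unfolding Inverse letter_rel_eq by blast
  from that[OF this truncated_image] show thesis .
next
  case (Direct x)
  let ?D = "\<lambda>i. C (Suc i)"
  have D: "N_word Q \<rho> ?D"
    by (rule N_word_Suc[OF C])
  have x: "x \<in> arcs Q" and head: "letter_head Q (?D 0) = tail Q x"
    using N_wordD(1,2)[OF C, of 0] Direct by (simp_all add: letter_tail_def)
  then have u: "tail Q x \<in> verts Q"
    by simp
  have dec: "truncated_image n ?D \<subseteq> truncated_image k ?D" if "k \<le> n" for k n
    using decseqD[OF decseq_truncated_image[OF D] that] .
  have range: "m1 \<in> range (e (tail Q x))" if "m1 \<in> truncated_image n ?D" for m1 n
    using truncated_image_subset[OF D, of n] that head by auto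
  have ex: "\<exists>m1\<in>truncated_image n ?D. arr x m1 = m" for n
  proof -
    have "m \<in> letter_rel Q \<rho> act (Direct x) `` truncated_image n ?D"
      using m[of "Suc n"] Direct by (simp del: letter_rel.simps)
    then show ?thesis
      unfolding letter_rel_Image by blast
  qed
  have rel: "(m1, m) \<in> letter_rel Q \<rho> act (C 0)" if "arr x m1 = m" "m1 \<in> truncated_image n ?D" for m1 n
    using range[OF that(2)] that(1) unfolding Direct letter_rel_eq by blast
  show thesis
  proof (cases "\<exists>k w. ?D k = Direct w")
    case False
    have inv: "\<exists>y. ?D n = Inverse y" for n
      using False by (cases "?D n") auto
    \<comment> \<open>With inverse letters only, each image is the full preimage of a full vertex
      part, so a preimage of \<open>m\<close> for \<open>n = 0\<close> serves for all
      \<open>n\<close>.\<close>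
    have const: "truncated_image n E = range (e (letter_head Q (E 0)))"
      if "N_word Q \<rho> E" "\<And>n. \<exists>y. E n = Inverse y" for n E
      using that
    proof (induction n arbitrary: E)
      case (Suc n)
      obtain y where y: "E 0 = Inverse y"
        using Suc.prems by blast
      have arcs: "y \<in> arcs Q" "head Q y \<in> verts Q"
        using N_wordD(1)[OF Suc.prems(1), of 0] y by simp_all
      have "truncated_image n (\<lambda>i. E (Suc i)) = range (e (letter_head Q (E (Suc 0))))"
        using Suc.IH[OF N_word_Suc[OF Suc.prems(1)]] Suc.prems(2) by blast
      also have "letter_head Q (E (Suc 0)) = head Q y"
        using N_wordD(2)[OF Suc.prems(1), of 0] y by (simp add: letter_tail_def)
      finally show ?case
        using y arcs by (auto simp: letter_rel_Image range_e[OF arcs(2)] e_arr simp del: letter_rel.simps)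
    qed simp
    obtain m1 where "m1 \<in> truncated_image 0 ?D" "arr x m1 = m"
      using ex by blast
    then show thesis
      using that[of m1] rel[of m1 0] const[OF D inv] by simp
  next
    case True
    define k where "k = (LEAST k. \<exists>w. ?D k = Direct w)"
    obtain w where w: "?D k = Direct w"
      using LeastI_ex[OF True] unfolding k_def ..
    have inv: "\<forall>i<k. \<exists>y. ?D i = Inverse y"
    proof (intro allI impI)
      fix i assume "i < k"
      from not_less_Least[OF this[unfolded k_def]] show "\<exists>y. ?D i = Inverse y"
        by (cases "?D i") auto
    qed
    \<comment> \<open>The chain starts at \<open>Suc k\<close>, the first stage that includes the
      direct letter \<open>w\<close> at index \<open>k\<close>; from there on all paths of length
      \<open>Suc k\<close> kill its members.\<close>
    define U where "U = (\<lambda>n. {d \<in> truncated_image (Suc k + n) ?D. arr x d = 0})"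
    interpret f: Vector_Spaces.linear scale scale "arr x"
      by (rule linear_arr[OF x])
    have subU: "subspace (U n)" for n
    proof -
      have "U n = truncated_image (Suc k + n) ?D \<inter> {d. arr x d = 0}"
        by (auto simp: U_def)
      then show ?thesis
        using subspace_inter[OF subspace_truncated_image[OF D] f.subspace_kernel] by (simp only:)
    qed
    have decU: "decseq U"
    proof (unfold decseq_def, intro allI impI)
      fix i j :: nat assume "i \<le> j"
      then have "truncated_image (Suc k + j) ?D \<subseteq> truncated_image (Suc k + i) ?D"
        by (intro dec) simp
      then show "U j \<subseteq> U i"
        unfolding U_def by blast
    qed
    have "U 0 \<subseteq> killed (Suc k) (tail Q x)"
    proof
      fix d assume "d \<in> U 0"
      then have d: "d \<in> truncated_image (Suc k) ?D" "arr x d = 0"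
        by (simp_all add: U_def del: truncated_image.simps)
      \<comment> \<open>A word with last letter \<open>x\<close> applies \<open>x\<close> first and
        so kills \<open>d\<close>; for the others \<open>word_kills_truncated_image\<close> applies,
        since \<open>C\<close> begins with \<open>x\<close>.\<close>
      have "foldr arr c d = 0" if c: "length c = Suc k" "set c \<subseteq> arcs Q" for c
      proof (cases "last c = x")
        case True
        have "c \<noteq> []" using c by auto
        then have eq: "c = butlast c @ [x]"
          using True append_butlast_last_id by metis
        have "foldr arr c d = foldr arr (butlast c) 0"
          by (subst eq) (simp add: d(2) del: append_butlast_last_id)
        also have "\<dots> = 0"
          using c by (intro word_zero) (auto dest: in_set_butlastD)
        finally show ?thesis .
      next
        case False
        show ?thesis
          by (rule word_kills_truncated_image[OF C inv w d(1) c]) (simp add: Direct False)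
      qed
      then show "d \<in> killed (Suc k) (tail Q x)"
        using range[OF d(1)] by (simp add: killed_def)
    qed
    from dccD[OF dcc[OF u] decU subU this] obtain n where n: "\<And>i. i \<ge> n \<Longrightarrow> U i = U n"
      by blast
    obtain m1 where m1: "m1 \<in> truncated_image (Suc k + n) ?D" "arr x m1 = m"
      using ex by blast
    \<comment> \<open>A preimage of \<open>m\<close> in a later stage differs from \<open>m1\<close>
      by an element of \<open>U n\<close>, which equals the later term of the chain; so
      \<open>m1\<close> lies in that stage as well.\<close>
    have "m1 \<in> truncated_image j ?D" for j
    proof (cases "j \<le> Suc k + n")
      case True
      then show ?thesis
        using m1 dec by blast
    next
      case False
      define i where "i = j - Suc k"
      have i: "j = Suc k + i" "n \<le> i"
        using False by (simp_all add: i_def)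
      obtain m2 where m2: "m2 \<in> truncated_image j ?D" "arr x m2 = m"
        using ex by blast
      have "m2 \<in> truncated_image (Suc k + n) ?D"
        using dec[of "Suc k + n" j] m2(1) i by (auto simp del: truncated_image.simps)
      then have "m1 - m2 \<in> U n"
        using m1 m2 subspace_diff[OF subspace_truncated_image[OF D]] by (simp add: U_def f.diff del: truncated_image.simps)
      then have "m1 - m2 \<in> truncated_image j ?D"
        using n[OF i(2)] i(1) unfolding U_def by blast
      then have "m1 - m2 + m2 \<in> truncated_image j ?D"
        using m2(1) subspace_add[OF subspace_truncated_image[OF D]] by blast
      then show ?thesis by simp
    qed
    then show thesis
      using that[of m1] rel[OF m1(2,1)] by blast
  qed
qed

section \<open>Comparison of \<open>word_plus\<close> with the intersection of the images\<close>

lemma word_plus_subset: "s 0 = m \<Longrightarrow> \<forall>n. s n \<in> letter_rel Q \<rho> act (C n) `` {s (Suc n)} \<Longrightarrow>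
    N_word Q \<rho> C \<Longrightarrow> m \<in> truncated_image n C"
proof (induction n arbitrary: C s m)
  case 0
  then show ?case
    using letter_rel_Image_subset[OF N_wordD(1)[OF 0(3), of 0], of "{s (Suc 0)}"] by auto
next
  case (Suc n)
  have "s (Suc 0) \<in> truncated_image n (\<lambda>i. C (Suc i))"
    using Suc.prems by (intro Suc.IH[of "\<lambda>i. s (Suc i)"] N_word_Suc) auto
  moreover have "(s (Suc 0), m) \<in> letter_rel Q \<rho> act (C 0)"
    using Suc.prems by auto
  ultimately show ?case by auto
qed

theorem realization:
  assumes "finitely_controlled Q \<rho> act \<or> pointwise_artinian Q \<rho> act" and C: "N_word Q \<rho> C"
  shows "word_plus Q \<rho> act C = (\<Inter>n. word_image Q \<rho> act (initial_word Q C n))"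
proof -
  have dcc: "dcc (killed j u)" if "u \<in> verts Q" for j u
    using assms(1) dcc_socle_artinian dcc_socle_finitely_controlled that by (intro dcc_killed) blast+
  have "m \<in> word_plus Q \<rho> act C" if m: "\<And>n. m \<in> truncated_image n C" for m
  proof -
    \<comment> \<open>The invariant of the dependent choice: the element at position
      \<open>k\<close> lies in all images of the word shifted by \<open>k\<close>, and the sequence
      starts at \<open>m\<close>.\<close>
    let ?P = "\<lambda>k m'. (\<forall>n. m' \<in> truncated_image n (\<lambda>i. C (k + i))) \<and> (k = 0 \<longrightarrow> m' = m)"
    have "\<exists>s. \<forall>k. ?P k (s k) \<and> (s (Suc k), s k) \<in> letter_rel Q \<rho> act (C k)"
    proof (rule dependent_nat_choice)
      show "\<exists>m'. ?P 0 m'" using m by auto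
    next
      fix m' k assume P: "?P k m'"
      obtain m1 where "(m1, m') \<in> letter_rel Q \<rho> act (C (k + 0))"
        "\<And>n. m1 \<in> truncated_image n (\<lambda>i. C (k + Suc i))"
        using word_image_step[OF dcc N_word_shift[OF C, of k], of m'] P by blast
      then show "\<exists>m1. ?P (Suc k) m1 \<and> (m1, m') \<in> letter_rel Q \<rho> act (C k)"
        by auto
    qed
    then show ?thesis
      unfolding word_plus_def by blast
  qed
  moreover have "m \<in> truncated_image n C" if "m \<in> word_plus Q \<rho> act C" for m n
    using that word_plus_subset[OF _ _ C] unfolding word_plus_def by blast
  ultimately show ?thesis
    using word_image_eq_truncated_image[OF C] by auto
qed

end

theorem lemma10p2:
  fixes Q :: "('v, 'a) pre_digraph"
    and \<rho> :: "('v, 'a) qpath set"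
    and act :: "('v, 'a, 'k::field, 'm::ab_group_add) quiver_action"
    and C :: "nat \<Rightarrow> 'a letter"
  assumes "string_algebra Q \<rho>"
    and "left_module (quiver_algebra Q \<rho>) act"
    and "finitely_controlled Q \<rho> act \<or> pointwise_artinian Q \<rho> act"
    and "N_word Q \<rho> C"
  shows "word_plus Q \<rho> act C = (\<Inter>n. word_image Q \<rho> act (initial_word Q C n))"
proof -
  interpret string_module Q \<rho> act
    using assms(1,2) by (intro string_module.intro string_module_axioms.intro)
  show ?thesis
    by (rule realization[OF assms(3,4)])
qed

end
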